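(* Let $\mathbb{X}\subseteq\mathbb{P}^2$ be a $\Bbbk$-configuration of type $(1,2,\dots,s)$ with $s\ge2$, and assume there are exactly $s+1$ lines in $\mathbb{P}^2$ containing $s$ points of $\mathbb{X}$. Then $\Delta\mathbf{H}_{m\mathbb{X}}(ms-1)=s+1$ for all integers $m\ge2$.
   Context: $\Bbbk$ is an algebraically closed field and $R=\Bbbk[x_0,x_1,x_2]$. A $\Bbbk$-configuration of type $(d_1,\dots,d_s)$ is a finite set $\mathbb{X}\subseteq\mathbb{P}^2$ for which there exist integers $1\le d_1<\cdots<d_s$, subsets $\mathbb{X}_1,\dots,\mathbb{X}_s$ of $\mathbb{X}$ and distinct lines $\mathbb{L}_1,\dots,\mathbb{L}_s\subseteq\mathbb{P}^2$ such that (1) $\mathbb{X}=\bigcup_{i=1}^s\mathbb{X}_i$; (2) $|\mathbb{X}_i|=d_i$ and $\mathbb{X}_i\subseteq\mathbb{L}_i$ for each $i$; (3) for $1<i\le s$, $\mathbb{L}_i$ contains no point of $\mathbb{X}_j$ for any $j<i$. For $\mathbb{X}=\{P_1,\dots,P_n\}$ and $m\ge1$, $m\mathbb{X}$ is the fat point scheme with ideal $I_{m\mathbb{X}}=I_{P_1}^m\cap\cdots\cap I_{P_n}^m$, where $I_P$ is the ideal of $P$. $\mathbf{H}_\mathbb{Z}(t)=\dim_\Bbbk R_t-\dim_\Bbbk(I_\mathbb{Z})_t$ and $\Delta\mathbf{H}_\mathbb{Z}(t)=\mathbf{H}_\mathbb{Z}(t)-\mathbf{H}_\mathbb{Z}(t-1)$,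 with $\mathbf{H}_\mathbb{Z}(t)=0$ for $t<0$. *)

theory Defs
  imports Main "HOL-Library.Poly_Mapping" "HOL-Computational_Algebra.Polynomial"
begin

type_synonym 'k vec3 = "'k \<times> 'k \<times> 'k"

definition proj_class :: "'k::field vec3 \<Rightarrow> 'k vec3 set" where
  "proj_class v = {(c * fst v, c * fst (snd v), c * snd (snd v)) | c. c \<noteq> 0}"

definition is_proj_point :: "'k::field vec3 set \<Rightarrow> bool" where
  "is_proj_point P \<longleftrightarrow> (\<exists>v. v \<noteq> (0,0,0) \<and> P = proj_class v)"

definition lin_eval :: "'k::field vec3 \<Rightarrow> 'k vec3 \<Rightarrow> 'k" where
  "lin_eval a v = fst a * fst v + fst (snd a) * fst (snd v) + snd (snd a) * snd (snd v)"

definition proj_line_of :: "'k::field vec3 \<Rightarrow> 'k vec3 set set" where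
  "proj_line_of a = {P. is_proj_point P \<and> (\<forall>v\<in>P. lin_eval a v = 0)}"

definition is_proj_line :: "'k::field vec3 set set \<Rightarrow> bool" where
  "is_proj_line L \<longleftrightarrow> (\<exists>a. a \<noteq> (0,0,0) \<and> L = proj_line_of a)"

definition k_configuration ::
  "'k::field vec3 set set \<Rightarrow> nat \<Rightarrow> (nat \<Rightarrow> nat) \<Rightarrow> bool" where
  "k_configuration X s d \<longleftrightarrow>
     finite X \<and> (\<forall>P\<in>X. is_proj_point P) \<and> s \<ge> 1 \<and>
     1 \<le> d 1 \<and> (\<forall>i\<in>{1..s}. \<forall>j\<in>{1..s}. i < j \<longrightarrow> d i < d j) \<and>
     (\<exists>Xs L. X = (\<Union>i\<in>{1..s}. Xs i) \<and>
        (\<forall>i\<in>{1..s}. Xs i \<subseteq> X \<and> card (Xs i) = d i \<and> is_proj_line (L i) \<and> Xs i \<subseteq> L i) \<and>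
        (\<forall>i\<in>{1..s}. \<forall>j\<in>{1..s}. i \<noteq> j \<longrightarrow> L i \<noteq> L j) \<and>
        (\<forall>i\<in>{1..s}. \<forall>j\<in>{1..s}. j < i \<longrightarrow> L i \<inter> Xs j = {}))"

text \<open>Polynomials are finitely supported maps from monomials (exponent vectors
  nat =>0 nat) to coefficients; R consists of those involving only x0,x1,x2.\<close>
type_synonym 'k mpoly = "(nat \<Rightarrow>\<^sub>0 nat) \<Rightarrow>\<^sub>0 'k"

definition var :: "nat \<Rightarrow> 'k::comm_ring_1 mpoly" where
  "var i = Poly_Mapping.single (Poly_Mapping.single i 1) 1"

definition const :: "'k::comm_ring_1 \<Rightarrow> 'k mpoly" where
  "const c = Poly_Mapping.single 0 c"

definition scale :: "'k::comm_ring_1 \<Rightarrow> 'k mpoly \<Rightarrow> 'k mpoly" where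
  "scale c p = const c * p"

definition tdeg :: "(nat \<Rightarrow>\<^sub>0 nat) \<Rightarrow> nat" where
  "tdeg m = (\<Sum>i\<in>Poly_Mapping.keys m. Poly_Mapping.lookup m i)"

definition ringR :: "'k::comm_ring_1 mpoly set" where
  "ringR = {p. \<forall>m\<in>Poly_Mapping.keys p. Poly_Mapping.keys m \<subseteq> {0,1,2}}"

definition ringR_deg :: "nat \<Rightarrow> 'k::comm_ring_1 mpoly set" where
  "ringR_deg t = {p \<in> ringR. \<forall>m\<in>Poly_Mapping.keys p. tdeg m = t}"

definition ideal_gen :: "'k::comm_ring_1 mpoly set \<Rightarrow> 'k mpoly set" where
  "ideal_gen S = {(\<Sum>g\<in>F. r g * g) | F r. finite F \<and> F \<subseteq> S \<and> (\<forall>g\<in>F. r g \<in> ringR)}"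

definition linear_form :: "'k::comm_ring_1 vec3 \<Rightarrow> 'k mpoly" where
  "linear_form a = const (fst a) * var 0 + const (fst (snd a)) * var 1 + const (snd (snd a)) * var 2"

definition point_ideal :: "'k::field vec3 set \<Rightarrow> 'k mpoly set" where
  "point_ideal P = ideal_gen {linear_form a | a. \<forall>v\<in>P. lin_eval a v = 0}"

definition ideal_power :: "'k::comm_ring_1 mpoly set \<Rightarrow> nat \<Rightarrow> 'k mpoly set" where
  "ideal_power I m = ideal_gen {prod_list fs | fs. length fs = m \<and> set fs \<subseteq> I}"

definition fat_ideal :: "'k::field vec3 set set \<Rightarrow> nat \<Rightarrow> 'k mpoly set" where
  "fat_ideal X m = ringR \<inter> (\<Inter>P\<in>X. ideal_power (point_ideal P) m)"

definition kdim :: "'k::field mpoly set \<Rightarrow> nat" where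
  "kdim V = vector_space.dim (scale :: 'k \<Rightarrow> 'k mpoly \<Rightarrow> 'k mpoly) V"

definition hilbert_fun :: "'k::field mpoly set \<Rightarrow> int \<Rightarrow> int" where
  "hilbert_fun I t = (if t < 0 then 0 else
     int (kdim (ringR_deg (nat t) :: 'k mpoly set)) - int (kdim (I \<inter> ringR_deg (nat t))))"

definition delta_hilbert_fun :: "'k::field mpoly set \<Rightarrow> int \<Rightarrow> int" where
  "delta_hilbert_fun I t = hilbert_fun I t - hilbert_fun I (t - 1)"

end

theory Submission
  imports Defs
begin

text \<open>
  Counting incidences shows that \<open>X\<close> is the star configuration of the \<open>s + 1\<close> lines: any two of
  them meet in a point of \<open>X\<close> and each point of \<open>X\<close> lies on exactly two of them. By Bezout, a form
  of degree less than \<open>ms\<close> in the ideal of \<open>mX\<close> is divisible by all \<open>s + 1\<close> lines, so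
  \<open>I(mX)\<^sub>t\<close> is isomorphic to \<open>I((m-2)X)\<close> in degree \<open>t - s - 1\<close> for \<open>t = ms - 1, ms - 2\<close>. In these
  degrees \<open>(m-2)X\<close> imposes independent conditions: the expected dimension is a lower bound because
  vanishing to order \<open>k\<close> at a point amounts to \<open>k (k + 1) / 2\<close> linear conditions, and it is an upper
  bound by residuating with respect to the lines one at a time.
\<close>

text \<open>Both uses of the lines rest on one count. Once the lines in \<open>A\<close> are split
  off, the multiplicities of \<open>kX\<close> along a further line \<open>L\<close> sum to
  \<open>k * s - card A\<close>, because each line of \<open>A\<close> meets \<open>L\<close> in
  exactly one point of \<open>X\<close>; the degree has dropped by \<open>card A\<close> as well.
  Hence the initial comparison of the degree with \<open>k * s\<close> decides every step: a degree
  below \<open>k * s\<close> forces each line, a degree of at least \<open>k * s - 1\<close> leaves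
  no superabundance on any line. Splitting off all \<open>s + 1\<close> lines lowers every
  multiplicity by 2, so the scheme is uniform again and induction applies.

  The number in the theorem is a difference of growth rates: from degree \<open>ms - 2\<close> to
  \<open>ms - 1\<close> the ring grows by \<open>ms\<close>, while the ideal grows like the system
  of \<open>(m-2)X\<close> from degree \<open>ms - s - 3\<close> to \<open>ms - s - 2\<close>, that
  is by \<open>ms - s - 1\<close>.

  The characteristic is arbitrary, so the order of vanishing is read off from
  \<open>F(p + T v)\<close> instead of derivatives; test directions and test points are plentiful
  because the field is infinite.\<close>

context vector_space
begin

text \<open>The space of all polynomials is infinite-dimensional, and \<open>dim\<close> is 0 for an
  infinite basis. The finite spanning set \<open>W\<close> in this and the next lemmas rules that
  case out.\<close>

lemma basis_of_subset_finite_span: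
  assumes "V \<subseteq> span W" "finite W"
  obtains B where "B \<subseteq> V" "independent B" "finite B" "V \<subseteq> span B" "card B = dim V"
proof -
  obtain B where B: "B \<subseteq> V" "independent B" "V \<subseteq> span B" "card B = dim V"
    using basis_exists by blast
  moreover have "finite B"
    using independent_span_bound[of W B] B(1,2) assms by blast
  ultimately show ?thesis using that by blast
qed

lemma dim_le_Suc_dim_kernel:
  assumes V: "subspace V" "V \<subseteq> span W" "finite W"
    and add: "\<And>x y. \<phi> (x + y) = \<phi> x + \<phi> y"
    and scl: "\<And>c x. \<phi> (scale c x) = c * \<phi> x"
  shows "dim V \<le> Suc (dim {x \<in> V. \<phi> x = 0})"
proof (cases "\<forall>x\<in>V. \<phi> x = 0")
  case True
  then have "{x \<in> V. \<phi> x = 0} = V" by auto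
  then show ?thesis by simp
next
  case False
  then obtain v where v: "v \<in> V" "\<phi> v \<noteq> 0" by auto
  let ?K = "{x \<in> V. \<phi> x = 0}"
  obtain B where B: "B \<subseteq> ?K" "independent B" "finite B" "?K \<subseteq> span B" "card B = dim ?K"
    using basis_of_subset_finite_span[of ?K W] V by auto
  have "V \<subseteq> span (insert v B)"
  proof
    fix x assume x: "x \<in> V"
    define c where "c = \<phi> x / \<phi> v"
    define y where "y = x - scale c v"
    have "y \<in> V" unfolding y_def using x v V(1) by (simp add: subspace_diff subspace_scale)
    moreover have "\<phi> x = \<phi> y + c * \<phi> v" using add[of y "scale c v"] by (simp add: y_def scl)
    then have "\<phi> y = 0" using v(2) by (simp add: c_def)
    ultimately have "y \<in> span B" using B(4) by auto
    then have "y \<in> span (insert v B)" using span_mono[of B "insert v B"] by auto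
    moreover have "scale c v \<in> span (insert v B)" by (simp add: span_scale span_base)
    ultimately have "y + scale c v \<in> span (insert v B)" by (rule span_add)
    then show "x \<in> span (insert v B)" by (simp add: y_def)
  qed
  then have "dim V \<le> card (insert v B)" using B(3) by (intro dim_le_card) auto
  also have "\<dots> \<le> Suc (card B)" using B(3) by (simp add: card_insert_if)
  finally show ?thesis using B(5) by simp
qed

lemma dim_le_dim_common_kernel:
  assumes "finite I" and V: "subspace V" "V \<subseteq> span W" "finite W"
    and add: "\<And>i x y. \<phi> i (x + y) = \<phi> i x + \<phi> i y"
    and scl: "\<And>i c x. \<phi> i (scale c x) = c * \<phi> i x"
  shows "dim V \<le> dim {x \<in> V. \<forall>i\<in>I. \<phi> i x = 0} + card I"
  using \<open>finite I\<close>
proof (induction I rule: finite_induct)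
  case empty
  then show ?case by simp
next
  case (insert j I)
  let ?K = "{x \<in> V. \<forall>i\<in>I. \<phi> i x = 0}"
  have zero: "\<phi> i 0 = 0" for i using scl[of i 0 0] by simp
  have "subspace ?K"
    unfolding subspace_def using V(1) by (auto simp: add scl zero subspace_add subspace_scale subspace_0)
  then have "dim ?K \<le> Suc (dim {x \<in> ?K. \<phi> j x = 0})"
    using V by (intro dim_le_Suc_dim_kernel[where W = W]) (auto simp: add scl)
  moreover have "{x \<in> ?K. \<phi> j x = 0} = {x \<in> V. \<forall>i\<in>insert j I. \<phi> i x = 0}" by auto
  ultimately show ?case using insert by simp
qed

lemma dim_image_inj:
  assumes f: "Vector_Spaces.linear scale scale f" "inj f" and V: "V \<subseteq> span W" "finite W"
  shows "dim (f ` V) = dim V"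
proof -
  interpret f: Vector_Spaces.linear scale scale f by fact
  obtain B where B: "B \<subseteq> V" "independent B" "finite B" "V \<subseteq> span B" "card B = dim V"
    using basis_of_subset_finite_span[OF V] .
  have "independent (f ` B)"
    using f.independent_injective_image[OF B(2)] f(2) inj_on_subset by blast
  moreover have "f ` V \<subseteq> span (f ` B)" using B(4) f.span_image[of B] by blast
  ultimately have "dim (f ` V) = card (f ` B)" using B(1) by (metis basis_card_eq_dim image_mono)
  also have "\<dots> = card B" using f(2) by (intro card_image) (blast intro: inj_on_subset)
  finally show ?thesis using B(5) by simp
qed

text \<open>The coefficients are indexed by \<open>I\<close> instead of by vectors, so that
  expansions of forms are indexed by exponent triples.\<close>

lemma span_image_finite:
  assumes "finite I"
  shows "span (f ` I) = range (\<lambda>c. \<Sum>t\<in>I. scale (c t) (f t))" (is "_ = ?R")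
proof
  have "subspace ?R"
    unfolding subspace_def
  proof (intro conjI ballI allI)
    show "0 \<in> ?R" by (rule image_eqI[where x = "\<lambda>_. 0"]) auto
    fix x y c assume "x \<in> ?R"
    then obtain a where a: "x = (\<Sum>t\<in>I. scale (a t) (f t))" by auto
    show "scale c x \<in> ?R"
      by (rule image_eqI[where x = "\<lambda>t. c * a t"]) (auto simp: a scale_sum_right)
    assume "y \<in> ?R"
    then obtain b where b: "y = (\<Sum>t\<in>I. scale (b t) (f t))" by auto
    show "x + y \<in> ?R"
      by (rule image_eqI[where x = "\<lambda>t. a t + b t"]) (auto simp: a b scale_left_distrib sum.distrib)
  qed
  moreover have "f ` I \<subseteq> ?R"
  proof
    fix x assume "x \<in> f ` I"
    then obtain i where i: "i \<in> I" "x = f i" by auto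
    have "(\<Sum>t\<in>I. scale (if t = i then 1 else 0) (f t)) = (\<Sum>t\<in>I. if t = i then f t else 0)"
      by (intro sum.cong) auto
    also have "\<dots> = f i" using i assms by (simp add: sum.delta')
    finally show "x \<in> ?R" using i by (intro image_eqI[where x = "\<lambda>t. if t = i then 1 else 0"]) simp_all
  qed
  ultimately show "span (f ` I) \<subseteq> ?R" by (rule span_minimal[rotated])
  show "?R \<subseteq> span (f ` I)"
    by (auto intro!: span_sum span_scale intro: span_base)
qed

end

section \<open>The polynomial ring as a vector space\<close>

lemma single_eq_const_mult: "Poly_Mapping.single m c = const c * Poly_Mapping.single m 1"
  by (simp add: const_def mult_single)

lemma const_add: "const (a + b) = const a + const b"
  by (simp add: const_def single_add)

lemma const_mult: "const (a * b) = const a * const b"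
  by (simp add: const_def mult_single)

lemma const_0 [simp]: "const 0 = 0" and const_1 [simp]: "const 1 = 1"
  by (simp_all add: const_def)

lemma lookup_const_mult: "Poly_Mapping.lookup (const c * p) m = c * Poly_Mapping.lookup p m"
  by (simp add: const_def map.rep_eq when_def flip: mult_map_scale_conv_mult)

lemma poly_mapping_eq_sum_single:
  "p = (\<Sum>m\<in>Poly_Mapping.keys p. Poly_Mapping.single m (Poly_Mapping.lookup p m))"
  by (rule poly_mapping_eqI)
    (auto simp: lookup_sum lookup_single when_def sum.delta' in_keys_iff)

interpretation mp: vector_space "scale :: 'k::field \<Rightarrow> 'k mpoly \<Rightarrow> 'k mpoly"
  by unfold_locales (simp_all add: scale_def const_add const_mult algebra_simps)

lemma kdim_eq_dim: "kdim V = mp.dim V"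
  by (simp add: kdim_def)

lemma scale_mult_left: "scale c p * q = scale c (p * q)"
  and scale_mult_right: "p * scale c q = scale c (p * q)"
  by (simp_all add: scale_def mult_ac)

lemma linear_mult_left: "Vector_Spaces.linear scale scale ((*) (p :: 'k::field mpoly))"
  by unfold_locales (simp_all add: scale_mult_right algebra_simps)

section \<open>Expansion along a line in the ambient vector space\<close>

definition ev_mono :: "'k::field vec3 \<Rightarrow> 'k vec3 \<Rightarrow> (nat \<Rightarrow>\<^sub>0 nat) \<Rightarrow> 'k poly" where
  "ev_mono p v m = [:fst p, fst v:] ^ Poly_Mapping.lookup m 0
     * [:fst (snd p), fst (snd v):] ^ Poly_Mapping.lookup m 1
     * [:snd (snd p), snd (snd v):] ^ Poly_Mapping.lookup m 2"

text \<open>The univariate polynomial \<open>F(p + T v)\<close> in \<open>T\<close>; variables of \<open>F\<close> other than the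
  three coordinates are set to 1.\<close>

definition ev :: "'k::field vec3 \<Rightarrow> 'k vec3 \<Rightarrow> 'k mpoly \<Rightarrow> 'k poly" where
  "ev p v F = (\<Sum>m\<in>Poly_Mapping.keys F. smult (Poly_Mapping.lookup F m) (ev_mono p v m))"

lemma ev_mono_add: "ev_mono p v (m + n) = ev_mono p v m * ev_mono p v n"
  by (simp add: ev_mono_def lookup_add power_add mult_ac)

lemma ev_superset:
  assumes "finite A" "Poly_Mapping.keys F \<subseteq> A"
  shows "ev p v F = (\<Sum>m\<in>A. smult (Poly_Mapping.lookup F m) (ev_mono p v m))"
  unfolding ev_def using assms by (intro sum.mono_neutral_left) (auto simp: in_keys_iff)

lemma ev_0 [simp]: "ev p v 0 = 0"
  by (simp add: ev_def)

lemma ev_single: "ev p v (Poly_Mapping.single m c) = smult c (ev_mono p v m)"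
  by (auto simp: ev_def)

lemma ev_add: "ev p v (F + G) = ev p v F + ev p v G"
proof -
  let ?A = "Poly_Mapping.keys F \<union> Poly_Mapping.keys G"
  have "ev p v (F + G) = (\<Sum>m\<in>?A. smult (Poly_Mapping.lookup (F + G) m) (ev_mono p v m))"
    by (intro ev_superset) (auto simp: keys_add)
  also have "\<dots> = ev p v F + ev p v G"
    by (subst (1 2) ev_superset[of ?A]) (auto simp: lookup_add smult_add_left sum.distrib)
  finally show ?thesis .
qed

lemma ev_sum: "ev p v (sum f A) = (\<Sum>x\<in>A. ev p v (f x))"
  by (induction A rule: infinite_finite_induct) (auto simp: ev_add)

lemma ev_mult: "ev p v (F * G) = ev p v F * ev p v G"
proof -
  have "F * G = (\<Sum>m\<in>Poly_Mapping.keys F. \<Sum>n\<in>Poly_Mapping.keys G.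
      Poly_Mapping.single (m + n) (Poly_Mapping.lookup F m * Poly_Mapping.lookup G n))"
    by (subst (1) poly_mapping_eq_sum_single[of F], subst (1) poly_mapping_eq_sum_single[of G])
      (simp only: sum_product mult_single)
  then have "ev p v (F * G) = (\<Sum>m\<in>Poly_Mapping.keys F. \<Sum>n\<in>Poly_Mapping.keys G.
      smult (Poly_Mapping.lookup F m) (ev_mono p v m) * smult (Poly_Mapping.lookup G n) (ev_mono p v n))"
    by (simp add: ev_sum ev_single ev_mono_add mult_ac)
  also have "\<dots> = ev p v F * ev p v G" by (simp add: ev_def sum_product)
  finally show ?thesis .
qed

lemma ev_const [simp]: "ev p v (const c) = [:c:]"
  by (simp add: const_def ev_single ev_mono_def)

lemma ev_1 [simp]: "ev p v 1 = 1"
  using ev_const[of p v 1] by simp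

lemma ev_scale: "ev p v (scale c F) = smult c (ev p v F)"
  by (simp add: scale_def ev_mult)

lemma ev_power: "ev p v (F ^ n) = ev p v F ^ n"
  by (induction n) (auto simp: ev_mult)

lemma ev_var: "ev p v (var 0) = [:fst p, fst v:]" "ev p v (var 1) = [:fst (snd p), fst (snd v):]"
  "ev p v (var 2) = [:snd (snd p), snd (snd v):]"
  by (simp_all add: var_def ev_single ev_mono_def lookup_single)

lemma ev_linear_form: "ev p v (linear_form a) = [:lin_eval a p, lin_eval a v:]"
  unfolding linear_form_def lin_eval_def ev_add ev_mult ev_const ev_var by simp

section \<open>Forms\<close>

text \<open>The degree is shifted by one so that the forms of degree \<open>-1\<close> (namely 0) are included.\<close>

definition forms :: "nat \<Rightarrow> 'k::comm_ring_1 mpoly set" where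
  "forms n = {p \<in> ringR. \<forall>m\<in>Poly_Mapping.keys p. Suc (tdeg m) = n}"

definition tri :: "nat \<Rightarrow> (nat \<times> nat \<times> nat) set" where
  "tri n = {(i, j, k). Suc (i + j + k) = n}"

lemma tri_eq: "tri n = (\<lambda>(i, j). (n - 1 - (i + j), i, j)) ` (SIGMA i:{..<n}. {..<n - i})"
  by (force simp: tri_def)

lemma finite_tri [simp, intro]: "finite (tri n)"
  by (simp add: tri_eq)

text \<open>For \<open>n = d + 1\<close> this is twice the binomial coefficient of
  \<open>d + 2\<close> over 2. Dimension counts are doubled throughout to avoid division in
  \<open>nat\<close>.\<close>

lemma card_tri: "2 * card (tri n) = n * Suc n"
proof -
  have "card (tri n) = card (SIGMA i:{..<n}. {..<n - i})"
    unfolding tri_eq by (intro card_image) (auto simp: inj_on_def)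
  also have "\<dots> = (\<Sum>i<n. n - i)" by simp
  also have "\<dots> = (\<Sum>i<n. Suc i)"
    by (rule sum.reindex_bij_witness[of _ "\<lambda>i. n - 1 - i" "\<lambda>i. n - 1 - i"]) auto
  also have "2 * \<dots> = n * Suc n" by (induction n) auto
  finally show ?thesis .
qed

definition expo :: "nat \<times> nat \<times> nat \<Rightarrow> (nat \<Rightarrow>\<^sub>0 nat)" where
  "expo t = (case t of (i, j, k) \<Rightarrow>
     Poly_Mapping.single 0 i + Poly_Mapping.single 1 j + Poly_Mapping.single 2 k)"

lemma lookup_expo: "Poly_Mapping.lookup (expo (i, j, k)) r =
    (if r = 0 then i else if r = 1 then j else if r = 2 then k else 0)"
  by (auto simp: expo_def lookup_add lookup_single)

lemma inj_expo: "inj expo"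
proof (rule injI)
  fix t t' assume eq: "expo t = expo t'"
  obtain i j k i' j' k' where t: "t = (i, j, k)" "t' = (i', j', k')" by (metis prod_cases3)
  with eq have "Poly_Mapping.lookup (expo (i, j, k)) r = Poly_Mapping.lookup (expo (i', j', k')) r" for r
    by simp
  from this[of 0] this[of 1] this[of 2] show "t = t'" by (simp add: lookup_expo t)
qed

lemma keys_expo: "Poly_Mapping.keys (expo t) \<subseteq> {0, 1, 2}"
  by (cases t) (auto simp: in_keys_iff lookup_expo split: if_splits)

lemma tdeg_eq:
  assumes "Poly_Mapping.keys m \<subseteq> {0, 1, 2}"
  shows "tdeg m = Poly_Mapping.lookup m 0 + Poly_Mapping.lookup m 1 + Poly_Mapping.lookup m 2"
proof -
  have "tdeg m = (\<Sum>i\<in>{0, 1, 2}. Poly_Mapping.lookup m i)"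
    unfolding tdeg_def using assms by (intro sum.mono_neutral_left) (auto simp: in_keys_iff)
  then show ?thesis by simp
qed

lemma tdeg_expo: "tdeg (expo (i, j, k)) = i + j + k"
  by (subst tdeg_eq[OF keys_expo]) (simp add: lookup_expo)

lemma expo_lookup:
  assumes "Poly_Mapping.keys m \<subseteq> {0, 1, 2}"
  shows "m = expo (Poly_Mapping.lookup m 0, Poly_Mapping.lookup m 1, Poly_Mapping.lookup m 2)"
  using assms by (intro poly_mapping_eqI) (auto simp: lookup_expo in_keys_iff)

text \<open>Kept generic so that the same triples index monomials in the variables, in linear forms,
  and in the univariate images of linear forms under \<open>ev\<close>.\<close>

definition fmono :: "'a::comm_monoid_mult \<Rightarrow> 'a \<Rightarrow> 'a \<Rightarrow> nat \<times> nat \<times> nat \<Rightarrow> 'a" where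
  "fmono x y z t = (case t of (i, j, k) \<Rightarrow> x ^ i * y ^ j * z ^ k)"

lemma var_power: "var i ^ n = Poly_Mapping.single (Poly_Mapping.single i n) 1"
  by (induction n) (auto simp: var_def mult_single simp flip: single_add)

lemma fmono_var: "fmono (var 0) (var 1) (var 2) t = Poly_Mapping.single (expo t) 1"
  by (cases t) (simp add: fmono_def var_power mult_single expo_def)

lemma ringR_0: "0 \<in> ringR" and ringR_const: "const c \<in> ringR"
  by (auto simp: ringR_def const_def)

lemma ringR_add: "p \<in> ringR \<Longrightarrow> q \<in> ringR \<Longrightarrow> p + q \<in> ringR"
  unfolding ringR_def using keys_add[of p q] by blast

lemma ringR_mult: assumes "p \<in> ringR" "q \<in> ringR" shows "p * q \<in> ringR"
proof -
  have "Poly_Mapping.keys (a + b) \<subseteq> {0, 1, 2}" if "a \<in> Poly_Mapping.keys p" "b \<in> Poly_Mapping.keys q" for a b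
    using that assms keys_add[of a b] unfolding ringR_def by blast
  then show ?thesis using keys_mult[of p q] unfolding ringR_def by blast
qed

lemma ringR_power: "p \<in> ringR \<Longrightarrow> p ^ n \<in> ringR"
  using ringR_const[of 1] by (induction n) (auto simp: ringR_mult)

lemma ringR_linear_form: "linear_form a \<in> ringR"
  unfolding linear_form_def
  by (intro ringR_add ringR_mult ringR_const) (auto simp: ringR_def var_def split: if_splits)

lemma subspace_forms: "mp.subspace (forms n)"
proof (rule mp.subspaceI)
  show "0 \<in> forms n" by (simp add: forms_def ringR_0)
  show "x + y \<in> forms n" if "x \<in> forms n" "y \<in> forms n" for x y :: "'a mpoly"
    using that keys_add[of x y] by (auto simp: forms_def ringR_add)
  show "scale c x \<in> forms n" if "x \<in> forms n" for c and x :: "'a mpoly"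
    using that by (auto simp: forms_def scale_def ringR_mult ringR_const in_keys_iff lookup_const_mult)
qed

lemma forms_eq_span_var: "(forms n :: 'a::field mpoly set) = mp.span (fmono (var 0) (var 1) (var 2) ` tri n)"
proof
  show "mp.span (fmono (var 0) (var 1) (var 2) ` tri n) \<subseteq> (forms n :: 'a mpoly set)"
  proof (intro mp.span_minimal subspace_forms subsetI)
    fix x :: "'a mpoly" assume "x \<in> fmono (var 0) (var 1) (var 2) ` tri n"
    then obtain t where t: "t \<in> tri n" "x = Poly_Mapping.single (expo t) 1" by (auto simp: fmono_var simp del: One_nat_def)
    then show "x \<in> forms n" using keys_expo[of t]
      by (cases t) (auto simp: forms_def ringR_def tri_def tdeg_expo)
  qed
  show "(forms n :: 'a mpoly set) \<subseteq> mp.span (fmono (var 0) (var 1) (var 2) ` tri n)"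
  proof
    fix p :: "'a mpoly" assume p: "p \<in> forms n"
    have "(\<Sum>m\<in>Poly_Mapping.keys p. scale (Poly_Mapping.lookup p m) (Poly_Mapping.single m 1))
        \<in> mp.span (fmono (var 0) (var 1) (var 2) ` tri n)"
    proof (rule mp.span_sum, rule mp.span_scale, rule mp.span_base)
      fix m assume "m \<in> Poly_Mapping.keys p"
      then have m: "Poly_Mapping.keys m \<subseteq> {0, 1, 2}" "Suc (tdeg m) = n"
        using p by (auto simp: forms_def ringR_def)
      then show "(Poly_Mapping.single m 1 :: 'a mpoly) \<in> fmono (var 0) (var 1) (var 2) ` tri n"
        using expo_lookup[OF m(1)] tdeg_eq[OF m(1)] unfolding fmono_var
        by (intro image_eqI[where x = "(Poly_Mapping.lookup m 0, Poly_Mapping.lookup m 1,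
              Poly_Mapping.lookup m 2)"]) (simp_all add: tri_def)
    qed
    then show "p \<in> mp.span (fmono (var 0) (var 1) (var 2) ` tri n)"
      using poly_mapping_eq_sum_single[of p] by (simp add: scale_def flip: single_eq_const_mult)
  qed
qed

lemma dim_forms: "2 * mp.dim (forms n :: 'k::field mpoly set) = n * Suc n"
proof -
  let ?f = "fmono (var 0) (var 1) (var 2) :: _ \<Rightarrow> 'k mpoly"
  have inj: "inj ?f" unfolding fmono_var inj_def
    by (metis inj_expo inj_eq lookup_single_eq lookup_single_not_eq zero_neq_one)
  have "mp.independent (?f ` tri n)"
  proof
    assume "mp.dependent (?f ` tri n)"
    then obtain S u x where S: "finite S" "S \<subseteq> ?f ` tri n" "(\<Sum>v\<in>S. scale (u v) v) = 0" "x \<in> S"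
      and ux: "u x \<noteq> 0"
      unfolding mp.dependent_explicit by blast
    then obtain t where t: "x = Poly_Mapping.single (expo t) 1" by (auto simp: fmono_var simp del: One_nat_def)
    have other: "Poly_Mapping.lookup v (expo t) = (if v = x then 1 else 0)" if v: "v \<in> S" for v
    proof -
      obtain t' where v': "v = Poly_Mapping.single (expo t') 1"
        using S(2) v by (auto simp: fmono_var simp del: One_nat_def)
      show ?thesis by (cases "v = x") (use v' in \<open>auto simp: t lookup_single when_def\<close>)
    qed
    have "0 = Poly_Mapping.lookup (\<Sum>v\<in>S. scale (u v) v) (expo t)" using S(3) by simp
    also have "\<dots> = (\<Sum>v\<in>S. u v * Poly_Mapping.lookup v (expo t))"
      by (simp add: lookup_sum scale_def lookup_const_mult)
    also have "\<dots> = (\<Sum>v\<in>S. if v = x then u x else 0)"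
      by (intro sum.cong) (auto simp: other)
    also have "\<dots> = u x" using S by simp
    finally show False using ux by simp
  qed
  then have "mp.dim (forms n :: 'k mpoly set) = card (?f ` tri n)"
    unfolding forms_eq_span_var by (rule mp.dim_span_eq_card_independent)
  also have "\<dots> = card (tri n)" using inj by (intro card_image) (blast intro: inj_on_subset)
  finally show ?thesis using card_tri by simp
qed

lemma forms_subset_finite_span:
  obtains W where "finite W" "forms n \<subseteq> mp.span W"
  using forms_eq_span_var[of n] that[of "fmono (var 0) (var 1) (var 2) ` tri n"] by auto

lemma span_fmono_mult:
  assumes "p \<in> mp.span (fmono x y z ` tri n)" "l \<in> mp.span {x, y, z}"
  shows "l * p \<in> mp.span (fmono x y z ` tri (Suc n))"
proof -
  let ?S = "mp.span (fmono x y z ` tri (Suc n))"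
  have gen: "l * fmono x y z t \<in> ?S" if l: "l \<in> {x, y, z}" and t: "t \<in> tri n" for l t
  proof -
    obtain i j k where ijk: "t = (i, j, k)" by (cases t)
    have "l * fmono x y z t \<in> fmono x y z ` {(Suc i, j, k), (i, Suc j, k), (i, j, Suc k)}"
      using l by (auto simp: fmono_def ijk mult_ac)
    also have "\<dots> \<subseteq> fmono x y z ` tri (Suc n)" using t by (intro image_mono) (auto simp: tri_def ijk)
    finally show ?thesis by (rule mp.span_base)
  qed
  have "l * q \<in> ?S" if q: "q \<in> fmono x y z ` tri n" for q
    using assms(2)
  proof (induction rule: mp.span_induct_alt)
    case base
    show ?case by (simp add: mp.span_zero)
  next
    case (step c a b)
    then show ?case using gen q
      by (auto simp: ring_distribs scale_mult_left intro!: mp.span_add mp.span_scale)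
  qed
  then have *: "l * q \<in> ?S" if "q \<in> fmono x y z ` tri n" for q using that .
  show ?thesis
    using assms(1)
  proof (induction rule: mp.span_induct_alt)
    case base
    show ?case by (simp add: mp.span_zero)
  next
    case (step c a b)
    then show ?case using * by (auto simp: ring_distribs scale_mult_right intro!: mp.span_add mp.span_scale)
  qed
qed

text \<open>A linear change of coordinates without substitution: the new monomials are built up from
  1, one linear factor at a time, and \<open>span_fmono_mult\<close> keeps each stage in the span of
  the old ones.\<close>

lemma span_fmono_mono:
  assumes "{x', y', z'} \<subseteq> mp.span {x, y, z}"
  shows "mp.span (fmono x' y' z' ` tri n) \<subseteq> mp.span (fmono x y z ` tri n)"
proof (intro mp.span_minimal mp.subspace_span subsetI)
  have pow: "l ^ i * p \<in> mp.span (fmono x y z ` tri (i + n))"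
    if "p \<in> mp.span (fmono x y z ` tri n)" "l \<in> mp.span {x, y, z}" for l p i n
    using that by (induction i) (auto simp: mult.assoc span_fmono_mult)
  have "fmono x y z (0, 0, 0) \<in> mp.span (fmono x y z ` tri 1)"
    by (intro mp.span_base imageI) (auto simp: tri_def)
  then have "x' ^ i * (y' ^ j * (z' ^ k * 1)) \<in> mp.span (fmono x y z ` tri (i + (j + (k + 1))))" for i j k
    using assms by (intro pow) (auto simp: fmono_def)
  then show "a \<in> mp.span (fmono x y z ` tri n)" if "a \<in> fmono x' y' z' ` tri n" for a
    using that by (auto simp: fmono_def tri_def mult.assoc add.assoc)
qed

section \<open>Adapted coordinates\<close>

definition lc :: "'k::field \<Rightarrow> 'k vec3 \<Rightarrow> 'k \<Rightarrow> 'k vec3 \<Rightarrow> 'k vec3" where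
  "lc a u b w = (a * fst u + b * fst w, a * fst (snd u) + b * fst (snd w),
     a * snd (snd u) + b * snd (snd w))"

lemma lin_eval_lc [simp]: "lin_eval l (lc a u b w) = a * lin_eval l u + b * lin_eval l w"
  by (simp add: lin_eval_def lc_def algebra_simps)

lemma lin_eval_commute: "lin_eval a v = lin_eval v a"
  by (simp add: lin_eval_def mult.commute)

lemma lin_eval_unit: "lin_eval a (1, 0, 0) = fst a" "lin_eval a (0, 1, 0) = fst (snd a)"
  "lin_eval a (0, 0, 1) = snd (snd a)"
  by (simp_all add: lin_eval_def)

text \<open>The last clause follows from biorthogonality; including it avoids inverting a matrix.\<close>

definition dual_bases :: "'k::field vec3 \<Rightarrow> 'k vec3 \<Rightarrow> 'k vec3 \<Rightarrow> 'k vec3 \<Rightarrow> 'k vec3 \<Rightarrow> 'k vec3 \<Rightarrow> bool" where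
  "dual_bases l0 l1 l2 e0 e1 e2 \<longleftrightarrow>
     lin_eval l0 e0 = 1 \<and> lin_eval l0 e1 = 0 \<and> lin_eval l0 e2 = 0 \<and>
     lin_eval l1 e0 = 0 \<and> lin_eval l1 e1 = 1 \<and> lin_eval l1 e2 = 0 \<and>
     lin_eval l2 e0 = 0 \<and> lin_eval l2 e1 = 0 \<and> lin_eval l2 e2 = 1 \<and>
     (\<forall>b v. lin_eval b v = lin_eval b e0 * lin_eval l0 v + lin_eval b e1 * lin_eval l1 v
        + lin_eval b e2 * lin_eval l2 v)"

lemma dual_basesD:
  assumes "dual_bases l0 l1 l2 e0 e1 e2"
  shows "lin_eval l0 e0 = 1" "lin_eval l0 e1 = 0" "lin_eval l0 e2 = 0"
    "lin_eval l1 e0 = 0" "lin_eval l1 e1 = 1" "lin_eval l1 e2 = 0"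
    "lin_eval l2 e0 = 0" "lin_eval l2 e1 = 0" "lin_eval l2 e2 = 1"
  using assms by (simp_all add: dual_bases_def)

lemma dual_bases_expand:
  assumes "dual_bases l0 l1 l2 e0 e1 e2"
  shows "lin_eval b v = lin_eval b e0 * lin_eval l0 v + lin_eval b e1 * lin_eval l1 v
        + lin_eval b e2 * lin_eval l2 v"
  using assms unfolding dual_bases_def by blast

lemma dual_bases_swap: "dual_bases l0 l1 l2 e0 e1 e2 \<Longrightarrow> dual_bases e0 e1 e2 l0 l1 l2"
  unfolding dual_bases_def
  by (metis (no_types, opaque_lifting) lin_eval_commute mult.commute)

text \<open>A nonzero coordinate of \<open>a\<close> serves as pivot; the other two coordinate forms
  complete the basis.\<close>

lemma dual_bases_form_exists:
  assumes "a \<noteq> (0, 0, 0)"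
  obtains l1 l2 e0 e1 e2 where "dual_bases a l1 l2 e0 e1 e2"
proof -
  obtain x y z where a: "a = (x, y, z)" by (metis prod_cases3)
  consider "x \<noteq> 0" | "y \<noteq> 0" | "z \<noteq> 0" using assms a by auto
  then show ?thesis
  proof cases
    case 1
    have "dual_bases a (0, 1, 0) (0, 0, 1) (1 / x, 0, 0) (- y / x, 1, 0) (- z / x, 0, 1)"
      using 1 by (simp add: dual_bases_def a lin_eval_def field_simps)
    then show ?thesis by (rule that)
  next
    case 2
    have "dual_bases a (1, 0, 0) (0, 0, 1) (0, 1 / y, 0) (1, - x / y, 0) (0, - z / y, 1)"
      using 2 by (simp add: dual_bases_def a lin_eval_def field_simps)
    then show ?thesis by (rule that)
  next
    case 3
    have "dual_bases a (1, 0, 0) (0, 1, 0) (0, 0, 1 / z) (1, 0, - x / z) (0, 1, - y / z)"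
      using 3 by (simp add: dual_bases_def a lin_eval_def field_simps)
    then show ?thesis by (rule that)
  qed
qed

text \<open>The pairing is symmetric, so a point can be completed by treating it as a form.\<close>

lemma dual_bases_point_exists:
  assumes "p \<noteq> (0, 0, 0)"
  obtains l0 l1 l2 e1 e2 where "dual_bases l0 l1 l2 p e1 e2"
  using dual_bases_form_exists[OF assms] dual_bases_swap by metis

text \<open>The parametrisation \<open>e1 + T e2\<close> of the line \<open>l0 = 0\<close> misses
  the point \<open>e2\<close>. The shear moves this missing point along the line, away from given
  points.\<close>

lemma dual_bases_shear:
  assumes "dual_bases l0 l1 l2 e0 e1 e2"
  shows "dual_bases l0 (lc 1 l1 (- c) l2) l2 e0 e1 (lc 1 e2 c e1)"
proof -
  have lc: "lin_eval (lc 1 l1 (- c) l2) v = lin_eval l1 v - c * lin_eval l2 v" for v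
    using lin_eval_lc[of v 1 l1 "- c" l2] by (simp add: lin_eval_commute)
  show ?thesis
    unfolding dual_bases_def
  proof (intro conjI allI)
    fix b v
    show "lin_eval b v = lin_eval b e0 * lin_eval l0 v + lin_eval b e1 * lin_eval (lc 1 l1 (- c) l2) v
        + lin_eval b (lc 1 e2 c e1) * lin_eval l2 v"
      unfolding lc lin_eval_lc using dual_bases_expand[OF assms, of b v] by (simp add: algebra_simps)
  qed (simp_all add: lc dual_basesD[OF assms])
qed

lemma linear_form_dual:
  assumes "dual_bases l0 l1 l2 e0 e1 e2"
  shows "linear_form b = scale (lin_eval b e0) (linear_form l0)
    + scale (lin_eval b e1) (linear_form l1) + scale (lin_eval b e2) (linear_form l2)"
proof -
  have eqs: "fst b = lin_eval b e0 * fst l0 + lin_eval b e1 * fst l1 + lin_eval b e2 * fst l2"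
    "fst (snd b) = lin_eval b e0 * fst (snd l0) + lin_eval b e1 * fst (snd l1) + lin_eval b e2 * fst (snd l2)"
    "snd (snd b) = lin_eval b e0 * snd (snd l0) + lin_eval b e1 * snd (snd l1) + lin_eval b e2 * snd (snd l2)"
    using dual_bases_expand[OF assms, of b "(1, 0, 0)"] dual_bases_expand[OF assms, of b "(0, 1, 0)"]
      dual_bases_expand[OF assms, of b "(0, 0, 1)"]
    by (simp_all only: lin_eval_unit)
  show ?thesis
    unfolding linear_form_def[of b] eqs const_add const_mult
    by (simp add: linear_form_def scale_def algebra_simps)
qed

lemma var_eq_linear_form:
  "var 0 = linear_form (1, 0, 0)" "var 1 = linear_form (0, 1, 0)" "var 2 = linear_form (0, 0, 1)"
  by (simp_all add: linear_form_def)

lemma linear_form_in_span: "linear_form a \<in> mp.span {var 0, var 1, var 2}"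
  unfolding linear_form_def scale_def[symmetric]
  by (intro mp.span_add mp.span_scale mp.span_base) auto

abbreviation lmono :: "'k::field vec3 \<Rightarrow> 'k vec3 \<Rightarrow> 'k vec3 \<Rightarrow> nat \<times> nat \<times> nat \<Rightarrow> 'k mpoly" where
  "lmono l0 l1 l2 \<equiv> fmono (linear_form l0) (linear_form l1) (linear_form l2)"

lemma forms_eq_span_lmono:
  assumes "dual_bases l0 l1 l2 e0 e1 e2"
  shows "forms n = mp.span (lmono l0 l1 l2 ` tri n)"
  unfolding forms_eq_span_var
proof (rule subset_antisym)
  have "linear_form b \<in> mp.span {linear_form l0, linear_form l1, linear_form l2}" for b
    unfolding linear_form_dual[OF assms, of b]
    by (intro mp.span_add mp.span_scale mp.span_base) auto
  then show "mp.span (fmono (var 0) (var 1) (var 2) ` tri n) \<subseteq> mp.span (lmono l0 l1 l2 ` tri n)"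
    by (intro span_fmono_mono) (simp add: var_eq_linear_form del: One_nat_def)
  show "mp.span (lmono l0 l1 l2 ` tri n) \<subseteq> mp.span (fmono (var 0) (var 1) (var 2) ` tri n)"
    by (intro span_fmono_mono) (simp add: linear_form_in_span del: One_nat_def)
qed

lemma forms_expansion:
  assumes "dual_bases l0 l1 l2 e0 e1 e2" "F \<in> forms n"
  obtains c where "F = (\<Sum>t\<in>tri n. scale (c t) (lmono l0 l1 l2 t))"
  using assms(2) unfolding forms_eq_span_lmono[OF assms(1)] mp.span_image_finite[OF finite_tri] by auto

lemma expansion_in_forms: "(\<Sum>t\<in>tri n. scale (c t) (lmono l0 l1 l2 t)) \<in> forms n"
proof -
  have "mp.span (lmono l0 l1 l2 ` tri n) \<subseteq> forms n"
    unfolding forms_eq_span_var by (intro span_fmono_mono) (simp add: linear_form_in_span del: One_nat_def)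
  then show ?thesis unfolding mp.span_image_finite[OF finite_tri] by auto
qed

lemma linear_form_mult_forms:
  "F \<in> forms n \<Longrightarrow> linear_form a * F \<in> forms (Suc n)" for a :: "'k::field vec3"
  unfolding forms_eq_span_var by (intro span_fmono_mult linear_form_in_span)

lemma linear_form_nonzero:
  fixes a :: "'k::field vec3"
  assumes "a \<noteq> (0, 0, 0)" shows "linear_form a \<noteq> 0"
proof
  assume "linear_form a = 0"
  moreover obtain l1 l2 e0 e1 e2 where "dual_bases a l1 l2 e0 e1 e2"
    using dual_bases_form_exists[OF assms] .
  ultimately show False using ev_linear_form[of e0 e0 a] by (simp add: dual_basesD)
qed

section \<open>Order of vanishing at a point\<close>

text \<open>Partial derivatives would misjudge the order in positive characteristic. For forms over
  an algebraically closed field this notion agrees with the power of the point ideal, by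
  \<open>ideal_power_vanishes\<close> and \<open>vanishes_ideal_power\<close>.\<close>

definition vanishes :: "'k::field vec3 \<Rightarrow> nat \<Rightarrow> 'k mpoly \<Rightarrow> bool" where
  "vanishes p m F \<longleftrightarrow> (\<forall>v. monom 1 m dvd ev p v F)"

lemma vanishes_iff: "vanishes p m F \<longleftrightarrow> (\<forall>v. \<forall>k<m. coeff (ev p v F) k = 0)"
  by (simp add: vanishes_def monom_1_dvd_iff')

lemma vanishes_0 [simp]: "vanishes p 0 F"
  by (simp add: vanishes_iff)

lemma subspace_vanishes: "mp.subspace {F. vanishes p m F}"
  by (rule mp.subspaceI) (auto simp: vanishes_def ev_add ev_scale dvd_add dvd_smult)

text \<open>Over a finite field, 1 plus the product of all \<open>X - x\<close> has no root.\<close>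

lemma infinite_alg_closed: "infinite (UNIV :: 'k::alg_closed_field set)"
proof
  assume fin: "finite (UNIV :: 'k set)"
  define q :: "'k poly" where "q = (\<Prod>x\<in>UNIV. [:- x, 1:])"
  have "degree q = card (UNIV :: 'k set)"
    unfolding q_def by (subst degree_prod_sum_eq) auto
  then have "degree (q + 1) > 0" using fin by (subst degree_add_eq_left) (auto simp: card_gt_0_iff)
  then obtain x where "poly (q + 1) x = 0" using alg_closed_imp_poly_has_root by blast
  moreover have "poly q x = 0" unfolding q_def poly_prod using fin by (simp add: prod_zero)
  ultimately show False by simp
qed

lemma ev_fmono: "ev p v (fmono x y z t) = fmono (ev p v x) (ev p v y) (ev p v z) t"
  by (cases t) (simp add: fmono_def ev_mult ev_power)

text \<open>Along \<open>e0 + T (a e1 + b e2)\<close> the form \<open>l0\<close> becomes 1,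
  \<open>l1\<close> becomes \<open>a T\<close> and \<open>l2\<close> becomes \<open>b T\<close>, so
  \<open>j + k\<close> is the order of a monomial at \<open>e0\<close>.\<close>

lemma ev_expansion_at_point:
  assumes "dual_bases l0 l1 l2 e0 e1 e2"
  shows "ev e0 (lc a e1 b e2) (\<Sum>t\<in>tri n. scale (c t) (lmono l0 l1 l2 t)) =
    (\<Sum>(i, j, k)\<in>tri n. monom (c (i, j, k) * a ^ j * b ^ k) (j + k))"
proof -
  have pow: "[:0, x:] ^ j = monom (x ^ j) j" for x :: 'a and j
    using monom_power[of x 1 j] by (simp add: monom_Suc monom_0)
  show ?thesis
    unfolding ev_sum
  proof (rule sum.cong[OF refl], clarify)
    fix i j k
    show "ev e0 (lc a e1 b e2) (scale (c (i, j, k)) (lmono l0 l1 l2 (i, j, k)))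
      = monom (c (i, j, k) * a ^ j * b ^ k) (j + k)"
      unfolding ev_scale ev_fmono ev_linear_form
      by (simp add: dual_basesD[OF assms] fmono_def pow mult_monom smult_monom mult.assoc
          flip: one_pCons)
  qed
qed

text \<open>As a function of \<open>b\<close>, the coefficient of \<open>T ^ d\<close> is a
  polynomial of degree at most \<open>d\<close> with coefficients \<open>c (i, j, k)\<close>,
  \<open>j + k = d\<close>. More than \<open>d\<close> zeros kill it.\<close>

lemma coeffs_vanish:
  assumes dual: "dual_bases l0 l1 l2 e0 e1 e2"
    and F: "F = (\<Sum>t\<in>tri n. scale (c t) (lmono l0 l1 l2 t))"
    and B: "finite B" "card B > d" "\<And>b. b \<in> B \<Longrightarrow> coeff (ev e0 (lc 1 e1 b e2) F) d = 0"
    and t: "(i, j, k) \<in> tri n" "j + k = d"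
  shows "c (i, j, k) = 0"
proof -
  define q where "q = (\<Sum>(i, j, k)\<in>tri n. if j + k = d then monom (c (i, j, k)) k else 0)"
  have "poly q b = coeff (ev e0 (lc 1 e1 b e2) F) d" for b
    unfolding F ev_expansion_at_point[OF dual] q_def
    by (auto simp: coeff_sum poly_sum poly_monom intro!: sum.cong)
  then have "poly q b = 0" if "b \<in> B" for b using B(3) that by simp
  moreover have "degree q \<le> d"
    unfolding q_def by (intro degree_sum_le) (auto intro!: order_trans[OF degree_monom_le])
  ultimately have "q = 0"
    using B(1,2) by (intro poly_eqI_degree[of B]) auto
  \<comment> \<open>The total degree fixes \<open>i\<close> and the order \<open>d\<close> fixes
    \<open>j\<close>, so \<open>k\<close> alone singles out one triple.\<close>
  have "coeff q k = (\<Sum>t'\<in>tri n. if t' = (i, j, k) then c t' else 0)"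
    unfolding q_def coeff_sum using t by (intro sum.cong) (auto simp: tri_def split: if_splits)
  also have "\<dots> = c (i, j, k)" using t by simp
  finally show ?thesis using \<open>q = 0\<close> by simp
qed

text \<open>The converse of \<open>coeffs_vanish\<close>, for all directions \<open>v\<close>
  including those with a component along \<open>e0\<close>: \<open>l1\<close> and \<open>l2\<close>
  still become multiples of \<open>T\<close>.\<close>

lemma vanishes_expansion:
  assumes dual: "dual_bases l0 l1 l2 e0 e1 e2"
    and F: "F = (\<Sum>t\<in>tri n. scale (c t) (lmono l0 l1 l2 t))"
    and c: "\<And>i j k. (i, j, k) \<in> tri n \<Longrightarrow> j + k < m \<Longrightarrow> c (i, j, k) = 0"
  shows "vanishes e0 m F"
  unfolding vanishes_def
proof
  fix v
  have "monom 1 m dvd smult (c t) (ev e0 v (lmono l0 l1 l2 t))" if "t \<in> tri n" for t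
  proof -
    obtain i j k where t: "t = (i, j, k)" by (cases t)
    show ?thesis
    proof (cases "j + k < m")
      case True
      then show ?thesis using c that t by simp
    next
      case False
      have "monom 1 1 dvd [:0, x:]" for x :: 'a
        unfolding monom_1_dvd_iff' by simp
      then have "monom 1 1 ^ j * monom 1 1 ^ k dvd [:0, lin_eval l1 v:] ^ j * [:0, lin_eval l2 v:] ^ k"
        by (intro mult_dvd_mono dvd_power_same)
      then have "monom 1 (j + k) dvd [:0, lin_eval l1 v:] ^ j * [:0, lin_eval l2 v:] ^ k"
        by (simp add: monom_power mult_monom)
      moreover have "monom (1 :: 'a) m dvd monom 1 (j + k)"
        using False by (simp add: monom_1_dvd_iff')
      ultimately have "monom 1 m dvd [:0, lin_eval l1 v:] ^ j * [:0, lin_eval l2 v:] ^ k"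
        by (rule dvd_trans[rotated])
      then show ?thesis
        unfolding t ev_fmono ev_linear_form unfolding fmono_def dual_basesD[OF dual] prod.case mult.assoc
        by (rule dvd_smult[OF dvd_mult])
    qed
  qed
  then show "monom 1 m dvd ev e0 v F"
    unfolding F ev_sum ev_scale by (rule dvd_sum)
qed

text \<open>Passing from order \<open>m\<close> to order \<open>m + 1\<close> needs only
  \<open>m + 1\<close> test directions, one for each coefficient with \<open>j + k = m\<close>. This
  is the source of the count of conditions at a point.\<close>

lemma vanishes_SucI:
  assumes dual: "dual_bases l0 l1 l2 p e1 e2" and F: "F \<in> forms n" "vanishes p m F"
    and B: "finite B" "card B > m" "\<And>b. b \<in> B \<Longrightarrow> coeff (ev p (lc 1 e1 b e2) F) m = 0"
  shows "vanishes p (Suc m) F"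
proof -
  obtain c where c: "F = (\<Sum>t\<in>tri n. scale (c t) (lmono l0 l1 l2 t))"
    using forms_expansion[OF dual F(1)] .
  show ?thesis
  proof (rule vanishes_expansion[OF dual c])
    fix i j k assume t: "(i, j, k) \<in> tri n" "j + k < Suc m"
    then have "coeff (ev p (lc 1 e1 b e2) F) (j + k) = 0" if "b \<in> B" for b
      using F(2) B(3) that unfolding vanishes_iff by (metis less_antisym)
    then show "c (i, j, k) = 0" using t B by (intro coeffs_vanish[OF dual c, of B "j + k"]) auto
  qed
qed

lemma vanishes_of_infinitely_many:
  assumes dual: "dual_bases l0 l1 l2 p e1 e2" and F: "F \<in> forms n" and B: "infinite B"
    and coeff: "\<And>b k. b \<in> B \<Longrightarrow> k < m \<Longrightarrow> coeff (ev p (lc 1 e1 b e2) F) k = 0"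
  shows "vanishes p m F"
  using coeff
proof (induction m)
  case (Suc m)
  obtain B' where "B' \<subseteq> B" "finite B'" "card B' = Suc m"
    using infinite_arbitrarily_large[OF B] by metis
  then show ?case using Suc by (intro vanishes_SucI[OF dual F, of m B']) auto
qed simp

text \<open>Raising the order from \<open>m\<close> to \<open>m + 1\<close> costs at most
  \<open>m + 1\<close> dimensions; the costs add up to \<open>m (m + 1) / 2\<close>.\<close>

lemma dim_le_dim_vanishes:
  fixes p :: "'k::alg_closed_field vec3"
  assumes p: "p \<noteq> (0, 0, 0)" and U: "mp.subspace U" "U \<subseteq> forms n"
  shows "2 * mp.dim U \<le> 2 * mp.dim {F \<in> U. vanishes p m F} + m * Suc m"
proof (induction m)
  case 0
  show ?case by simp
next
  case (Suc m)
  obtain l0 l1 l2 e1 e2 where dual: "dual_bases l0 l1 l2 p e1 e2"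
    using dual_bases_point_exists[OF p] .
  obtain B :: "'k set" where B: "finite B" "card B = Suc m"
    using infinite_arbitrarily_large[OF infinite_alg_closed] by metis
  obtain W :: "'k mpoly set" where W: "finite W" "forms n \<subseteq> mp.span W"
    using forms_subset_finite_span .
  let ?V = "{F \<in> U. vanishes p m F}"
  have "mp.subspace ?V"
    using mp.subspace_inter[OF U(1) subspace_vanishes[of p m]] by (simp add: Int_def)
  then have "mp.dim ?V \<le> mp.dim {F \<in> ?V. \<forall>b\<in>B. coeff (ev p (lc 1 e1 b e2) F) m = 0} + card B"
    using U(2) W by (intro mp.dim_le_dim_common_kernel[where W = W] B(1)) (auto simp: ev_add ev_scale)
  also have "{F \<in> ?V. \<forall>b\<in>B. coeff (ev p (lc 1 e1 b e2) F) m = 0} = {F \<in> U. vanishes p (Suc m) F}"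
  proof (intro set_eqI iffI; elim CollectE conjE; intro CollectI conjI)
    fix F assume "F \<in> U" "vanishes p m F" "\<forall>b\<in>B. coeff (ev p (lc 1 e1 b e2) F) m = 0"
    then show "vanishes p (Suc m) F" using U(2) B by (intro vanishes_SucI[OF dual, of F n m B]) auto
  qed (simp_all add: vanishes_iff del: split_paired_All)
  finally show ?case using Suc B(2) by simp
qed

section \<open>Multiplying by a linear form\<close>

lemma coeff_linear_mult: "coeff ([:a, b:] * q) (Suc k) = a * coeff q (Suc k) + b * coeff q k"
  "coeff ([:a, b:] * q) 0 = a * coeff q 0"
  for a :: "'k::field"
  by (simp_all add: coeff_pCons)

lemma vanishes_linear_mult: "vanishes p m G \<Longrightarrow> vanishes p m (linear_form a * G)"
  by (simp add: vanishes_def ev_mult del: mult_pCons_left)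

lemma vanishes_linear_mult_Suc:
  assumes "lin_eval a p = 0" "vanishes p m G"
  shows "vanishes p (Suc m) (linear_form a * G)"
  unfolding vanishes_iff
proof (intro allI impI)
  fix v k assume "k < Suc m"
  then show "coeff (ev p v (linear_form a * G)) k = 0" using assms
    by (cases k) (auto simp: ev_mult ev_linear_form vanishes_iff coeff_linear_mult
        simp del: mult_pCons_left split_paired_All)
qed

text \<open>The constant term of the linear factor is nonzero, so the factor is a unit modulo powers
  of \<open>T\<close> and can be cancelled coefficient by coefficient.\<close>

lemma vanishes_linear_cancel:
  assumes "lin_eval a p \<noteq> 0" "vanishes p m (linear_form a * G)"
  shows "vanishes p m G"
  unfolding vanishes_iff
proof (intro allI impI)
  fix v k assume "k < m"
  then show "coeff (ev p v G) k = 0"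
  proof (induction k)
    case 0
    then have "coeff (ev p v (linear_form a * G)) 0 = 0"
      using assms(2) by (simp add: vanishes_iff del: split_paired_All)
    then show ?case using assms(1)
      by (simp add: ev_mult ev_linear_form coeff_linear_mult del: mult_pCons_left)
  next
    case (Suc k)
    then have "coeff (ev p v (linear_form a * G)) (Suc k) = 0"
      using assms(2) by (simp add: vanishes_iff del: split_paired_All)
    then show ?case using assms(1) Suc
      by (simp add: ev_mult ev_linear_form coeff_linear_mult del: mult_pCons_left)
  qed
qed

text \<open>In a direction along the line the factor becomes 0 and nothing can be cancelled; in
  every other direction it is a nonzero multiple of \<open>T\<close>. Infinitely many of these good
  directions decide the order.\<close>

lemma vanishes_linear_cancel_Suc:
  fixes a :: "'k::alg_closed_field vec3"
  assumes a: "a \<noteq> (0, 0, 0)" and p: "p \<noteq> (0, 0, 0)" "lin_eval a p = 0"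
    and G: "G \<in> forms n" "vanishes p (Suc m) (linear_form a * G)"
  shows "vanishes p m G"
proof -
  obtain l0 l1 l2 e1 e2 where dual: "dual_bases l0 l1 l2 p e1 e2"
    using dual_bases_point_exists[OF p(1)] .
  define B where "B = {b. lin_eval a (lc 1 e1 b e2) \<noteq> 0}"
  obtain m1 m2 f0 f1 f2 where af: "dual_bases a m1 m2 f0 f1 f2"
    using dual_bases_form_exists[OF a] .
  have nz: "lin_eval a e1 \<noteq> 0 \<or> lin_eval a e2 \<noteq> 0"
    using dual_bases_expand[OF dual, of a f0] dual_basesD[OF af] p(2) by auto
  \<comment> \<open>Since \<open>a\<close> is nonzero but vanishes at \<open>p\<close>, it is
    nonzero at \<open>e1\<close> or \<open>e2\<close>; hence at most one \<open>b\<close> is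
    bad.\<close>
  have "- B \<subseteq> {- lin_eval a e1 / lin_eval a e2}"
  proof
    fix b assume "b \<in> - B"
    then have eq: "lin_eval a e1 + b * lin_eval a e2 = 0" by (simp add: B_def)
    with nz have e2: "lin_eval a e2 \<noteq> 0" by auto
    show "b \<in> {- lin_eval a e1 / lin_eval a e2}"
      unfolding singleton_iff nonzero_eq_divide_eq[OF e2]
      using eq by (simp add: eq_neg_iff_add_eq_0 add.commute)
  qed
  then have "infinite B"
    using infinite_alg_closed[where 'k = 'k] by (metis finite.emptyI finite_insert finite_subset finite_compl)
  then show ?thesis
  proof (rule vanishes_of_infinitely_many[OF dual G(1)])
    fix b k assume "b \<in> B" "k < m"
    then have "coeff (ev p (lc 1 e1 b e2) (linear_form a * G)) (Suc k) = 0"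
      using G(2) by (simp add: vanishes_iff del: split_paired_All)
    then show "coeff (ev p (lc 1 e1 b e2) G) k = 0" using \<open>b \<in> B\<close> p(2)
      by (simp add: ev_mult ev_linear_form coeff_linear_mult B_def del: mult_pCons_left lin_eval_lc)
  qed
qed

section \<open>Powers of point ideals\<close>

declare split_paired_All [simp del] split_paired_Ex [simp del]

lemma ideal_gen_0: "0 \<in> ideal_gen S"
  unfolding ideal_gen_def by (auto intro!: exI[of _ "{}"])

lemma ideal_gen_add:
  assumes "f \<in> ideal_gen S" "g \<in> ideal_gen S"
  shows "f + g \<in> ideal_gen S"
proof -
  obtain A r where A: "finite A" "A \<subseteq> S" "\<forall>g\<in>A. r g \<in> ringR" "f = (\<Sum>g\<in>A. r g * g)"
    using assms(1) unfolding ideal_gen_def by blast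
  obtain B q where B: "finite B" "B \<subseteq> S" "\<forall>g\<in>B. q g \<in> ringR" "g = (\<Sum>g\<in>B. q g * g)"
    using assms(2) unfolding ideal_gen_def by blast
  define h where "h x = (if x \<in> A then r x else 0) + (if x \<in> B then q x else 0)" for x
  have "(\<Sum>x\<in>A \<union> B. h x * x) = (\<Sum>x\<in>A \<union> B. if x \<in> A then r x * x else 0)
      + (\<Sum>x\<in>A \<union> B. if x \<in> B then q x * x else 0)"
    unfolding sum.distrib[symmetric] h_def by (intro sum.cong) (auto simp: algebra_simps)
  also have "\<dots> = f + g"
    unfolding A(4) B(4) using A(1) B(1)
    by (intro arg_cong2[of _ _ _ _ "(+)"] sum.mono_neutral_cong_right) auto
  finally show ?thesis
    unfolding ideal_gen_def using A B
    by (intro CollectI exI[of _ "A \<union> B"] exI[of _ h]) (auto simp: h_def ringR_add ringR_0)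
qed

lemma ideal_gen_sum: "(\<And>x. x \<in> A \<Longrightarrow> f x \<in> ideal_gen S) \<Longrightarrow> sum f A \<in> ideal_gen S"
  by (induction A rule: infinite_finite_induct) (auto simp: ideal_gen_0 ideal_gen_add)

lemma ideal_gen_generator: "g \<in> S \<Longrightarrow> r \<in> ringR \<Longrightarrow> r * g \<in> ideal_gen S"
  unfolding ideal_gen_def by (intro CollectI exI[of _ "{g}"] exI[of _ "\<lambda>_. r"]) auto

lemma is_proj_pointD:
  assumes "is_proj_point P" "p \<in> P"
  shows "p \<noteq> (0, 0, 0)" "P = proj_class p"
proof -
  obtain v where v: "v \<noteq> (0, 0, 0)" "P = proj_class v" using assms(1) unfolding is_proj_point_def by blast
  obtain c where c: "c \<noteq> 0" "p = (c * fst v, c * fst (snd v), c * snd (snd v))"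
    using assms(2) v(2) unfolding proj_class_def by blast
  show "p \<noteq> (0, 0, 0)" using v(1) c by (cases v) auto
  have "proj_class v = proj_class p"
  proof (intro set_eqI iffI)
    fix w assume "w \<in> proj_class v"
    then obtain d where d: "d \<noteq> 0" "w = (d * fst v, d * fst (snd v), d * snd (snd v))"
      unfolding proj_class_def by blast
    then show "w \<in> proj_class p" unfolding proj_class_def using c
      by (intro CollectI exI[of _ "d / c"]) auto
  next
    fix w assume "w \<in> proj_class p"
    then obtain d where d: "d \<noteq> 0" "w = (d * fst p, d * fst (snd p), d * snd (snd p))"
      unfolding proj_class_def by blast
    then show "w \<in> proj_class v" unfolding proj_class_def using c
      by (intro CollectI exI[of _ "d * c"]) auto
  qed
  then show "P = proj_class p" using v(2) by simp
qed

lemma self_in_proj_class: "p \<in> proj_class p"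
  unfolding proj_class_def by (intro CollectI exI[of _ 1]) simp

lemma proj_point_nonempty: "is_proj_point P \<Longrightarrow> P \<noteq> {}"
  unfolding is_proj_point_def using self_in_proj_class by blast

lemma lin_eval_proj_class:
  assumes "w \<in> proj_class p"
  shows "lin_eval a w = 0 \<longleftrightarrow> lin_eval a p = 0"
proof -
  obtain d where d: "d \<noteq> 0" "w = (d * fst p, d * fst (snd p), d * snd (snd p))"
    using assms unfolding proj_class_def by blast
  then have "lin_eval a w = d * lin_eval a p" by (simp add: lin_eval_def algebra_simps)
  then show ?thesis using d by simp
qed

lemma point_ideal_vanishes:
  assumes "f \<in> point_ideal P" "p \<in> P"
  shows "vanishes p 1 f"
proof -
  obtain A r where A: "A \<subseteq> {linear_form a | a. \<forall>v\<in>P. lin_eval a v = 0}" "f = (\<Sum>g\<in>A. r g * g)"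
    using assms(1) unfolding point_ideal_def ideal_gen_def by blast
  have "monom 1 1 dvd ev p v (r g * g)" if g: "g \<in> A" for g v
  proof -
    obtain a where "g = linear_form a" "lin_eval a p = 0" using A(1) g assms(2) by blast
    then have "monom 1 1 dvd ev p v g" by (simp add: ev_linear_form monom_1_dvd_iff')
    then show ?thesis unfolding ev_mult by (rule dvd_mult)
  qed
  then show ?thesis unfolding vanishes_def A(2) ev_sum by (intro allI dvd_sum)
qed

lemma ideal_power_vanishes:
  assumes "f \<in> ideal_power (point_ideal P) m" "p \<in> P"
  shows "vanishes p m f"
proof -
  obtain A r where A: "A \<subseteq> {prod_list fs | fs. length fs = m \<and> set fs \<subseteq> point_ideal P}"
      "f = (\<Sum>g\<in>A. r g * g)"
    using assms(1) unfolding ideal_power_def ideal_gen_def by blast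
  have list: "monom 1 (length fs) dvd ev p v (prod_list fs)" if "set fs \<subseteq> point_ideal P" for fs v
    using that
  proof (induction fs)
    case Nil
    show ?case by simp
  next
    case (Cons g fs)
    have "monom 1 1 * monom 1 (length fs) dvd ev p v g * ev p v (prod_list fs)"
      using Cons point_ideal_vanishes[OF _ assms(2)] by (intro mult_dvd_mono) (auto simp: vanishes_def)
    then show ?case by (simp add: mult_monom ev_mult)
  qed
  have "monom 1 m dvd ev p v (r g * g)" if "g \<in> A" for g v
    unfolding ev_mult using A(1) that list by (intro dvd_mult) blast
  then show ?thesis unfolding vanishes_def A(2) ev_sum by (intro allI dvd_sum)
qed

lemma linear_form_in_point_ideal: "(\<forall>v\<in>P. lin_eval a v = 0) \<Longrightarrow> linear_form a \<in> point_ideal P"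
  using ideal_gen_generator[of "linear_form a" "{linear_form a |a. \<forall>v\<in>P. lin_eval a v = 0}" 1]
    ringR_const[of 1] unfolding point_ideal_def by auto

text \<open>In coordinates centred at \<open>p\<close> only monomials with
  \<open>j + k \<ge> m\<close> survive, and each of them contains \<open>m\<close> factors among
  \<open>l1\<close> and \<open>l2\<close>, which lie in the point ideal.\<close>

lemma vanishes_ideal_power:
  fixes p :: "'k::alg_closed_field vec3"
  assumes P: "is_proj_point P" "p \<in> P" and F: "F \<in> forms n" "vanishes p m F"
  shows "F \<in> ideal_power (point_ideal P) m"
proof -
  note p = is_proj_pointD[OF P]
  obtain l0 l1 l2 e1 e2 where dual: "dual_bases l0 l1 l2 p e1 e2"
    using dual_bases_point_exists[OF p(1)] .
  obtain c where c: "F = (\<Sum>t\<in>tri n. scale (c t) (lmono l0 l1 l2 t))"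
    using forms_expansion[OF dual F(1)] .
  have l: "linear_form l1 \<in> point_ideal P" "linear_form l2 \<in> point_ideal P"
    using lin_eval_proj_class dual_basesD[OF dual] unfolding p(2) by (blast intro: linear_form_in_point_ideal)+
  have "scale (c t) (lmono l0 l1 l2 t) \<in> ideal_power (point_ideal P) m" if "t \<in> tri n" for t
  proof -
    obtain i j k where t: "t = (i, j, k)" by (cases t)
    show ?thesis
    proof (cases "j + k < m")
      case True
      obtain B :: "'k set" where B: "finite B" "card B = Suc (j + k)"
        using infinite_arbitrarily_large[OF infinite_alg_closed] by metis
      have "c (i, j, k) = 0" using that F(2) True B unfolding t vanishes_iff
        by (intro coeffs_vanish[OF dual c, of B "j + k"]) auto
      then show ?thesis by (simp add: t ideal_power_def ideal_gen_0)
    next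
      case False
      \<comment> \<open>Exactly \<open>m\<close> factors go into the generator of the power; the
        surplus ones join the multiplier.\<close>
      define j' where "j' = min j m"
      define k' where "k' = m - j'"
      have jk: "j' \<le> j" "k' \<le> k" "j' + k' = m" using False by (auto simp: j'_def k'_def)
      let ?L = "linear_form l0" let ?M = "linear_form l1" let ?N = "linear_form l2"
      let ?r = "const (c t) * ?L ^ i * ?M ^ (j - j') * ?N ^ (k - k')"
      let ?g = "prod_list (replicate j' ?M @ replicate k' ?N)"
      have "?M ^ j = ?M ^ (j - j') * ?M ^ j'" "?N ^ k = ?N ^ (k - k') * ?N ^ k'"
        using jk by (simp_all flip: power_add)
      then have "scale (c t) (lmono l0 l1 l2 t) = ?r * ?g"
        unfolding t fmono_def scale_def by (simp add: mult_ac)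
      also have "\<dots> \<in> ideal_power (point_ideal P) m"
        unfolding ideal_power_def using jk l
        by (intro ideal_gen_generator ringR_mult ringR_power ringR_const ringR_linear_form CollectI
            exI[of _ "replicate j' ?M @ replicate k' ?N"]) (auto simp: set_replicate_conv_if)
      finally show ?thesis .
    qed
  qed
  then show ?thesis unfolding c by (subst ideal_power_def, intro ideal_gen_sum) (simp add: ideal_power_def)
qed

section \<open>Restriction to a line\<close>

lemma sum_order_le_degree:
  fixes f :: "'k::field poly"
  assumes "f \<noteq> 0" "finite A"
  shows "(\<Sum>x\<in>A. order x f) \<le> degree f"
proof -
  have "(\<Sum>x\<in>A. order x f) = (\<Sum>x\<in>A \<inter> set_mset (proots f). count (proots f) x)"
    using assms by (intro sum.mono_neutral_cong_right) (auto simp: order_root)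
  also have "\<dots> \<le> (\<Sum>x\<in>set_mset (proots f). count (proots f) x)"
    by (intro sum_mono2) auto
  also have "\<dots> = size (proots f)" by (simp add: size_multiset_overloaded_eq)
  also have "\<dots> \<le> degree f" by (rule size_proots_le)
  finally show ?thesis .
qed

lemma pcompose_power: "pcompose (q ^ n) r = pcompose q r ^ n"
  for q :: "'k::field poly"
  by (induction n) (auto simp: pcompose_mult pcompose_1)

lemma ev_shift: "pcompose (ev u w F) [:c, 1:] = ev (lc 1 u c w) w F"
proof -
  have "pcompose (ev_mono u w m) [:c, 1:] = ev_mono (lc 1 u c w) w m" for m
    unfolding ev_mono_def pcompose_mult pcompose_power
    by (simp add: lc_def pcompose_pCons algebra_simps)
  then show ?thesis by (simp add: ev_def pcompose_sum pcompose_smult)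
qed

text \<open>Substituting \<open>T + c\<close> moves the base point from \<open>u\<close> to
  \<open>u + c w\<close>; shifting back turns the order at that point into the multiplicity of the
  root \<open>c\<close>.\<close>

lemma vanishes_imp_dvd:
  fixes u :: "'a::field vec3"
  assumes "vanishes (lc 1 u c w) m F"
  shows "[:- c, 1:] ^ m dvd ev u w F"
proof -
  have "monom 1 m dvd pcompose (ev u w F) [:c, 1:]"
    using assms by (simp add: ev_shift vanishes_def)
  then obtain q where "pcompose (ev u w F) [:c, 1:] = monom 1 m * q" by (rule dvdE)
  then have "pcompose (pcompose (ev u w F) [:c, 1:]) [:- c, 1:] = pcompose (monom 1 m) [:- c, 1:] * pcompose q [:- c, 1:]"
    by (simp add: pcompose_mult)
  moreover have "pcompose [:c, 1:] [:- c, 1:] = [:0, 1:]" by (simp add: pcompose_pCons)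
  moreover have "pcompose (monom 1 m) [:- c, 1:] = [:- c, 1:] ^ m"
  proof -
    have "monom 1 m = [:0, 1 :: 'a:] ^ m" using monom_power[of "1 :: 'a" 1 m] by (simp add: monom_Suc monom_0)
    then show ?thesis by (simp add: pcompose_power pcompose_pCons)
  qed
  ultimately show ?thesis by (simp flip: pcompose_assoc)
qed

lemma degree_ev: assumes "F \<in> forms (Suc n)" shows "degree (ev u w F) \<le> n"
proof -
  have "degree (ev_mono u w m) \<le> n" if "m \<in> Poly_Mapping.keys F" for m
  proof -
    have m: "Poly_Mapping.keys m \<subseteq> {0, 1, 2}" "tdeg m = n" using assms that by (auto simp: forms_def ringR_def)
    have "degree ([:a, b:] ^ k) \<le> k" for a b :: 'a and k
      using degree_power_le[of "[:a, b:]" k] by (simp split: if_splits)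
    then show ?thesis
      unfolding ev_mono_def m(2)[symmetric] tdeg_eq[OF m(1)]
      by (intro order_trans[OF degree_mult_le] add_mono)
  qed
  then show ?thesis
    unfolding ev_def by (intro degree_sum_le) (auto intro: order_trans[OF degree_smult_le])
qed

text \<open>On the line \<open>y1\<close> becomes 1 and \<open>y2\<close> becomes \<open>T\<close>,
  so the terms free of \<open>a\<close> restrict to distinct powers of \<open>T\<close> and must
  vanish one by one.\<close>

lemma divisible_if_zero_on_line:
  assumes dual: "dual_bases a y1 y2 e0 e1 e2" and F: "F \<in> forms (Suc n)" and 0: "ev e1 e2 F = 0"
  obtains G where "G \<in> forms n" "F = linear_form a * G"
proof -
  obtain c where c: "F = (\<Sum>t\<in>tri (Suc n). scale (c t) (lmono a y1 y2 t))"
    using forms_expansion[OF dual F] .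
  have pow: "[:0, 1:] ^ k = monom (1 :: 'a) k" for k
    using monom_power[of "1 :: 'a" 1 k] by (simp add: monom_Suc monom_0)
  have restr: "ev e1 e2 F = (\<Sum>(i, j, k)\<in>tri (Suc n). if i = 0 then monom (c (i, j, k)) k else 0)"
    unfolding c ev_sum
  proof (rule sum.cong[OF refl], clarify)
    fix i j k
    show "ev e1 e2 (scale (c (i, j, k)) (lmono a y1 y2 (i, j, k))) =
        (if i = 0 then monom (c (i, j, k)) k else 0)"
      unfolding ev_scale ev_fmono ev_linear_form
      unfolding fmono_def dual_basesD[OF dual] prod.case pow
      by (simp add: smult_monom flip: one_pCons)
  qed
  have c0: "c (0, j, k) = 0" if "(0, j, k) \<in> tri (Suc n)" for j k
  proof -
    have "0 = coeff (ev e1 e2 F) k" using 0 by simp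
    also have "\<dots> = (\<Sum>t\<in>tri (Suc n). if t = (0, j, k) then c t else 0)"
      unfolding restr coeff_sum using that by (intro sum.cong) (auto simp: tri_def split: if_splits)
    also have "\<dots> = c (0, j, k)" using that by simp
    finally show ?thesis by simp
  qed
  let ?s = "\<lambda>(i, j, k). (Suc i, j, k) :: nat \<times> nat \<times> nat"
  have "F = (\<Sum>t\<in>?s ` tri n. scale (c t) (lmono a y1 y2 t))"
    unfolding c
  proof (rule sum.mono_neutral_right)
    show "\<forall>t\<in>tri (Suc n) - ?s ` tri n. scale (c t) (lmono a y1 y2 t) = 0"
    proof
      fix t assume t: "t \<in> tri (Suc n) - ?s ` tri n"
      obtain i j k where ijk: "t = (i, j, k)" by (cases t)
      show "scale (c t) (lmono a y1 y2 t) = 0"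
        using t c0[of j k] unfolding ijk by (cases i) (force simp: tri_def)+
    qed
  qed (rule finite_tri, auto simp: tri_def)
  also have "\<dots> = (\<Sum>t\<in>tri n. scale (c (?s t)) (lmono a y1 y2 (?s t)))"
    by (subst sum.reindex) (auto simp: inj_on_def)
  also have "\<dots> = linear_form a * (\<Sum>t\<in>tri n. scale (c (?s t)) (lmono a y1 y2 t))"
    by (auto simp: sum_distrib_left fmono_def scale_def mult_ac intro!: sum.cong)
  finally show ?thesis by (rule that[OF expansion_in_forms])
qed

text \<open>A form of degree \<open>n\<close> in \<open>U\<close> restricts to a binary form on the line with the prescribed
  zeros, and finitely many further evaluations on the line detect whether this restriction is zero.\<close>

lemma dim_le_dim_line_multiples:
  fixes a :: "'k::alg_closed_field vec3"
  assumes a: "a \<noteq> (0, 0, 0)"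
    and S: "finite S" "S \<subseteq> proj_line_of a"
    and U: "mp.subspace U" "U \<subseteq> forms (Suc n)"
    and van: "\<And>F P p. F \<in> U \<Longrightarrow> P \<in> S \<Longrightarrow> p \<in> P \<Longrightarrow> vanishes p (\<mu> P) F"
  shows "mp.dim U \<le> mp.dim {F \<in> U. \<exists>G\<in>forms n. F = linear_form a * G} + (Suc n - (\<Sum>P\<in>S. \<mu> P))"
proof -
  obtain y1 y2 e0 e1 e2 where dual: "dual_bases a y1 y2 e0 e1 e2"
    using dual_bases_form_exists[OF a] .
  define rep where "rep P = (SOME p. p \<in> P)" for P :: "'k vec3 set"
  have pp: "is_proj_point P" if "P \<in> S" for P using S(2) that by (auto simp: proj_line_of_def)
  have rep: "rep P \<in> P" if "P \<in> S" for P
    unfolding rep_def using proj_point_nonempty[OF pp[OF that]] by (simp add: some_in_eq)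
  have a_rep: "lin_eval a (rep P) = 0" if "P \<in> S" for P
    using S(2) that rep[OF that] by (auto simp: proj_line_of_def)
  have nz: "lin_eval y1 (rep P) \<noteq> 0 \<or> lin_eval y2 (rep P) \<noteq> 0" if "P \<in> S" for P
  proof (rule ccontr)
    assume "\<not> ?thesis"
    then have "lin_eval b (rep P) = 0" for b
      using dual_bases_expand[OF dual, of b "rep P"] a_rep[OF that] by simp
    from this[of "(1, 0, 0)"] this[of "(0, 1, 0)"] this[of "(0, 0, 1)"] have "rep P = (0, 0, 0)"
      by (cases "rep P") (simp add: lin_eval_def)
    then show False using is_proj_pointD(1)[OF pp rep, OF that that] by simp
  qed
  \<comment> \<open>The shear constant avoids finitely many values so that the point
    \<open>w\<close>, which \<open>e1 + T w\<close> misses, is not in \<open>S\<close>. If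
    \<open>lin_eval y2 (rep P) = 0\<close>, the quotient is the default 0, which is harmless: then
    \<open>lin_eval y1 (rep P) \<noteq> 0\<close>.\<close>
  obtain g where g: "g \<notin> (\<lambda>P. lin_eval y1 (rep P) / lin_eval y2 (rep P)) ` S"
    using S(1) infinite_alg_closed[where 'k = 'k] ex_new_if_finite by blast
  define w where "w = lc 1 e2 g e1"
  define z1 where "z1 = lc 1 y1 (- g) y2"
  have dual': "dual_bases a z1 y2 e0 e1 w"
    unfolding w_def z1_def by (rule dual_bases_shear[OF dual])
  have z1_nz: "lin_eval z1 (rep P) \<noteq> 0" if "P \<in> S" for P
  proof
    assume "lin_eval z1 (rep P) = 0"
    then have eq: "lin_eval y1 (rep P) = g * lin_eval y2 (rep P)"
      using lin_eval_lc[of "rep P" 1 y1 "- g" y2] by (simp add: z1_def lin_eval_commute)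
    then have "lin_eval y2 (rep P) \<noteq> 0" using nz[OF that] by auto
    then have "g = lin_eval y1 (rep P) / lin_eval y2 (rep P)" using eq by simp
    then show False using g that by blast
  qed
  define c where "c P = lin_eval y2 (rep P) / lin_eval z1 (rep P)" for P
  have mem: "lc 1 e1 (c P) w \<in> P" if "P \<in> S" for P
  proof -
    have eq: "lin_eval b (rep P) = lin_eval z1 (rep P) * lin_eval b (lc 1 e1 (c P) w)" for b
      using dual_bases_expand[OF dual', of b "rep P"] a_rep[OF that] z1_nz[OF that]
      by (simp add: c_def field_simps)
    have "lc 1 e1 (c P) w \<in> proj_class (rep P)"
      unfolding proj_class_def
    proof (intro CollectI exI conjI)
      show "1 / lin_eval z1 (rep P) \<noteq> 0" using z1_nz[OF that] by simp
      show "lc 1 e1 (c P) w = (1 / lin_eval z1 (rep P) * fst (rep P),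
          1 / lin_eval z1 (rep P) * fst (snd (rep P)), 1 / lin_eval z1 (rep P) * snd (snd (rep P)))"
        using eq[of "(1, 0, 0)"] eq[of "(0, 1, 0)"] eq[of "(0, 0, 1)"] z1_nz[OF that]
        by (simp add: lin_eval_commute[of "(_, _, _)"] lin_eval_unit prod_eq_iff del: lin_eval_lc)
    qed
    then show ?thesis using is_proj_pointD(2)[OF pp rep, OF that that] by simp
  qed
  have inj: "inj_on c S"
  proof (rule inj_onI)
    fix P Q assume PQ: "P \<in> S" "Q \<in> S" "c P = c Q"
    then show "P = Q"
      using mem[of P] mem[of Q] is_proj_pointD(2)[OF pp, of _ "lc 1 e1 (c P) w"] by metis
  qed
  \<comment> \<open>Auxiliary points bring the number of prescribed zeros up to
    \<open>n + 1\<close>, one more than the degree. The truncated difference is 0 when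
    \<open>S\<close> alone already provides enough.\<close>
  obtain T :: "'k set" where T: "finite T" "card T = Suc n - (\<Sum>P\<in>S. \<mu> P)" "T \<inter> c ` S = {}"
  proof -
    have "infinite (- (c ` S))" using S(1) infinite_alg_closed[where 'k = 'k] by (simp add: finite_compl)
    then obtain T where "T \<subseteq> - (c ` S)" "finite T" "card T = Suc n - (\<Sum>P\<in>S. \<mu> P)"
      using infinite_arbitrarily_large by metis
    then show ?thesis using that by blast
  qed
  obtain W :: "'k mpoly set" where W: "finite W" "forms (Suc n) \<subseteq> mp.span W"
    using forms_subset_finite_span .
  have "mp.dim U \<le> mp.dim {F \<in> U. \<forall>t\<in>T. poly (ev e1 w F) t = 0} + card T"
    using U W by (intro mp.dim_le_dim_common_kernel[where W = W] T(1)) (auto simp: ev_add ev_scale)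
  also have "{F \<in> U. \<forall>t\<in>T. poly (ev e1 w F) t = 0} = {F \<in> U. \<exists>G\<in>forms n. F = linear_form a * G}"
  proof (intro set_eqI iffI; elim CollectE conjE; intro CollectI conjI)
    fix F assume F: "F \<in> U" "\<forall>t\<in>T. poly (ev e1 w F) t = 0"
    have "ev e1 w F = 0"
    proof (rule ccontr)
      assume nz: "ev e1 w F \<noteq> 0"
      have 1: "1 \<le> order t (ev e1 w F)" if "t \<in> T" for t
        using F(2) that nz by (simp add: order_root Suc_le_eq)
      have 2: "\<mu> P \<le> order (c P) (ev e1 w F)" if "P \<in> S" for P
        using vanishes_imp_dvd[OF van[OF F(1) that mem[OF that]]] nz by (simp add: order_divides)
      have "Suc n \<le> (\<Sum>P\<in>S. \<mu> P) + card T" using T(2) by simp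
      also have "\<dots> \<le> (\<Sum>P\<in>S. order (c P) (ev e1 w F)) + (\<Sum>t\<in>T. order t (ev e1 w F))"
        using sum_mono[of S \<mu>, OF 2] sum_mono[of T "\<lambda>_. 1" "\<lambda>t. order t (ev e1 w F)", OF 1]
        by simp
      also have "\<dots> = (\<Sum>t\<in>c ` S \<union> T. order t (ev e1 w F))"
        using S(1) T inj by (subst sum.union_disjoint) (auto simp: sum.reindex)
      also have "\<dots> \<le> degree (ev e1 w F)" using nz S(1) T(1) by (intro sum_order_le_degree) auto
      also have "\<dots> \<le> n" using F(1) U(2) by (intro degree_ev) auto
      finally show False by simp
    qed
    then show "\<exists>G\<in>forms n. F = linear_form a * G"
      using divisible_if_zero_on_line[OF dual'] F(1) U(2) by blast
  next
    fix F assume "\<exists>G\<in>forms n. F = linear_form a * G"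
    then show "\<forall>t\<in>T. poly (ev e1 w F) t = 0"
      by (auto simp: ev_mult ev_linear_form dual_basesD[OF dual'])
  qed
  finally show ?thesis by (simp add: T(2))
qed

section \<open>Star configurations\<close>

text \<open>Double counting. Weight 1 counts points on lines; weighting each point by its number of
  lines counts pairs of lines.\<close>

lemma sum_weighted_incidences:
  fixes f :: "'a \<Rightarrow> 'b::comm_semiring_1"
  assumes "finite X" "finite A"
  shows "(\<Sum>P\<in>X. f P * of_nat (card {L\<in>A. P \<in> L})) = (\<Sum>L\<in>A. \<Sum>P\<in>X \<inter> L. f P)"
proof -
  have "f P * of_nat (card {L\<in>A. P \<in> L}) = (\<Sum>L\<in>A. if P \<in> L then f P else 0)" for P
    using assms(2) by (simp add: sum.If_cases Int_def mult.commute)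
  then have "(\<Sum>P\<in>X. f P * of_nat (card {L\<in>A. P \<in> L})) = (\<Sum>L\<in>A. \<Sum>P\<in>X. if P \<in> L then f P else 0)"
    by (simp add: sum.swap[of _ A X])
  also have "\<dots> = (\<Sum>L\<in>A. \<Sum>P\<in>X \<inter> L. f P)"
    using assms(1) by (simp add: sum.If_cases)
  finally show ?thesis .
qed

lemma proj_line_of_iff:
  assumes "is_proj_point P" "p \<in> P"
  shows "P \<in> proj_line_of a \<longleftrightarrow> lin_eval a p = 0"
  unfolding proj_line_of_def
  using assms lin_eval_proj_class is_proj_pointD(2)[OF assms] by blast

text \<open>On the line of \<open>a\<close>, the form \<open>b\<close> restricts to a binary linear
  form with coefficients \<open>b1\<close>, \<open>b2\<close>. If that is nonzero, its zero is
  unique up to scaling.\<close>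

lemma proj_lines_meet_at_most_once:
  assumes L: "is_proj_line L" "is_proj_line L'" "L \<noteq> L'" and PQ: "P \<in> L" "P \<in> L'" "Q \<in> L" "Q \<in> L'"
  shows "P = Q"
proof -
  obtain a b where a: "a \<noteq> (0, 0, 0)" "L = proj_line_of a" and b: "L' = proj_line_of b"
    using L unfolding is_proj_line_def by blast
  obtain y1 y2 e0 e1 e2 where dual: "dual_bases a y1 y2 e0 e1 e2"
    using dual_bases_form_exists[OF a(1)] .
  have pts: "is_proj_point P" "is_proj_point Q" using PQ by (auto simp: a(2) proj_line_of_def)
  obtain p q where pq: "p \<in> P" "q \<in> Q" using pts proj_point_nonempty by blast
  have ev: "lin_eval a p = 0" "lin_eval b p = 0" "lin_eval a q = 0" "lin_eval b q = 0"
    using PQ pq by (auto simp: a(2) b proj_line_of_def)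
  define b1 b2 where "b1 = lin_eval b e1" and "b2 = lin_eval b e2"
  have nz: "b1 \<noteq> 0 \<or> b2 \<noteq> 0"
  proof (rule ccontr)
    assume "\<not> (b1 \<noteq> 0 \<or> b2 \<noteq> 0)"
    \<comment> \<open>Otherwise \<open>b\<close> is \<open>d\<close> times \<open>a\<close>: for
      \<open>d \<noteq> 0\<close> the two lines coincide, and for \<open>d = 0\<close> the set
      \<open>L'\<close> would contain every point of the plane.\<close>
    define d where "d = lin_eval b e0"
    with \<open>\<not> (b1 \<noteq> 0 \<or> b2 \<noteq> 0)\<close> have b_eq: "lin_eval b v = d * lin_eval a v" for v
      using dual_bases_expand[OF dual, of b v] by (simp add: b1_def b2_def)
    obtain b' where b': "b' \<noteq> (0, 0, 0)" "L' = proj_line_of b'"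
      using L unfolding is_proj_line_def by blast
    show False
    proof (cases "d = 0")
      case False
      then have "L = L'" unfolding a(2) b proj_line_of_def by (simp add: b_eq)
      then show False using L(3) by simp
    next
      case True
      then have all: "R \<in> proj_line_of b'" if "is_proj_point R" for R
        using that b b_eq b'(2) unfolding proj_line_of_def by auto
      obtain m1 m2 f0 f1 f2 where dual': "dual_bases b' m1 m2 f0 f1 f2"
        using dual_bases_form_exists[OF b'(1)] .
      have "f0 \<noteq> (0, 0, 0)" using dual_basesD(1)[OF dual'] by (auto simp: lin_eval_def)
      then have "is_proj_point (proj_class f0)" unfolding is_proj_point_def by blast
      from all[OF this] have "lin_eval b' f0 = 0"
        using self_in_proj_class[of f0] unfolding proj_line_of_def by blast
      then show False using dual_basesD(1)[OF dual'] by simp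
    qed
  qed
  define p1 p2 q1 q2 where "p1 = lin_eval y1 p" and "p2 = lin_eval y2 p"
    and "q1 = lin_eval y1 q" and "q2 = lin_eval y2 q"
  have xp: "lin_eval c p = lin_eval c e1 * p1 + lin_eval c e2 * p2" for c
    using dual_bases_expand[OF dual, of c p] ev by (simp add: p1_def p2_def)
  have xq: "lin_eval c q = lin_eval c e1 * q1 + lin_eval c e2 * q2" for c
    using dual_bases_expand[OF dual, of c q] ev by (simp add: q1_def q2_def)
  have "b1 * p1 + b2 * p2 = 0" "b1 * q1 + b2 * q2 = 0"
    using xp[of b] xq[of b] ev by (simp_all add: b1_def b2_def)
  \<comment> \<open>Cramer's rule: the coordinates of \<open>p\<close> and \<open>q\<close> on the
    line are two solutions of one nonzero equation, so their determinant vanishes.\<close>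
  then have "b1 * (p1 * q2 - p2 * q1) = 0" "b2 * (p1 * q2 - p2 * q1) = 0" by algebra+
  then have cross: "p1 * q2 = p2 * q1" using nz by auto
  have zero: "v = (0, 0, 0)" if "\<And>c. lin_eval c v = 0" for v :: "'a vec3"
    using that[of "(1, 0, 0)"] that[of "(0, 1, 0)"] that[of "(0, 0, 1)"]
    by (cases v) (simp add: lin_eval_def)
  have "p1 \<noteq> 0 \<or> p2 \<noteq> 0"
    using zero[of p] xp is_proj_pointD(1)[OF pts(1) pq(1)] by auto
  moreover have "q1 \<noteq> 0 \<or> q2 \<noteq> 0"
    using zero[of q] xq is_proj_pointD(1)[OF pts(2) pq(2)] by auto
  ultimately obtain r where r: "r \<noteq> 0" "q1 = r * p1" "q2 = r * p2"
  proof (cases "p1 = 0")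
    case True
    with \<open>p1 \<noteq> 0 \<or> p2 \<noteq> 0\<close> cross have "p2 \<noteq> 0" "q1 = 0" by auto
    then show ?thesis using True \<open>q1 \<noteq> 0 \<or> q2 \<noteq> 0\<close> by (intro that[of "q2 / p2"]) auto
  next
    case False
    have "q1 \<noteq> 0" using False cross \<open>q1 \<noteq> 0 \<or> q2 \<noteq> 0\<close> by auto
    then show ?thesis using False cross by (intro that[of "q1 / p1"]) (auto simp: field_simps)
  qed
  have eq: "lin_eval c q = r * lin_eval c p" for c
    unfolding xp xq r by (simp add: algebra_simps)
  have "q = (r * fst p, r * fst (snd p), r * snd (snd p))"
    using eq[of "(1, 0, 0)"] eq[of "(0, 1, 0)"] eq[of "(0, 0, 1)"]
    by (cases q) (simp add: lin_eval_def)
  then have "q \<in> proj_class p" unfolding proj_class_def using r(1) by blast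
  then have "q \<in> P" using is_proj_pointD(2)[OF pts(1) pq(1)] by simp
  then show "P = Q" using is_proj_pointD(2)[OF pts(1)] is_proj_pointD(2)[OF pts(2) pq(2)] by metis
qed

locale star_configuration =
  fixes X :: "'k::alg_closed_field vec3 set set" and LL :: "'k vec3 set set set" and s :: nat
  assumes finite_X: "finite X" and points: "P \<in> X \<Longrightarrow> is_proj_point P"
    and finite_LL: "finite LL" and card_LL: "card LL = Suc s" and s_ge_2: "s \<ge> 2"
    and lines: "L \<in> LL \<Longrightarrow> is_proj_line L"
    and card_line: "L \<in> LL \<Longrightarrow> card (X \<inter> L) = s"
    and card_meet: "L \<in> LL \<Longrightarrow> L' \<in> LL \<Longrightarrow> L \<noteq> L' \<Longrightarrow> card (X \<inter> L \<inter> L') = 1"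
    and two_lines: "P \<in> X \<Longrightarrow> card {L\<in>LL. P \<in> L} = 2"

text \<open>Counting incidences gives \<open>\<Sum> r\<^sub>P = 2 |X|\<close> for the numbers \<open>r\<^sub>P\<close> of lines through the points,
  and counting pairs of lines gives \<open>\<Sum> (r\<^sub>P - 1) (r\<^sub>P - 2) \<le> 0\<close>.\<close>

lemma star_configurationI:
  fixes X :: "'k::alg_closed_field vec3 set set"
  assumes s: "s \<ge> 2" and X: "finite X" "\<And>P. P \<in> X \<Longrightarrow> is_proj_point P" "2 * card X = s * Suc s"
    and LL: "card LL = Suc s" "\<And>L. L \<in> LL \<Longrightarrow> is_proj_line L" "\<And>L. L \<in> LL \<Longrightarrow> card (X \<inter> L) = s"
  shows "star_configuration X LL s"
proof -
  have fin: "finite LL" using LL(1) card.infinite by fastforce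
  define r :: "'k vec3 set \<Rightarrow> int" where "r P = int (card {L\<in>LL. P \<in> L})" for P
  define c :: "'k vec3 set set \<Rightarrow> 'k vec3 set set \<Rightarrow> int" where "c L L' = int (card (X \<inter> L \<inter> L'))" for L L'
  have c_le: "c L L' \<le> 1" if "L \<in> LL" "L' \<in> LL - {L}" for L L'
  proof -
    have "card (X \<inter> L \<inter> L') \<le> Suc 0"
      using that LL(2) X(1) proj_lines_meet_at_most_once[of L L'] by (subst card_le_Suc0_iff_eq) auto
    then show ?thesis by (simp add: c_def)
  qed
  have sum_r: "(\<Sum>P\<in>X. r P) = int (s * Suc s)"
    using sum_weighted_incidences[OF X(1) fin, of "\<lambda>_. 1 :: int"] LL(1,3) by (simp add: r_def ring_distribs)
  have "(\<Sum>P\<in>X. r P * r P) = (\<Sum>L\<in>LL. \<Sum>P\<in>X \<inter> L. r P)"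
    unfolding r_def by (rule sum_weighted_incidences[OF X(1) fin])
  also have "\<dots> = (\<Sum>L\<in>LL. \<Sum>L'\<in>LL. c L L')"
    using sum_weighted_incidences[OF _ fin, of "X \<inter> L" "\<lambda>_. 1 :: int" for L] X(1)
    by (simp add: r_def c_def)
  also have "\<dots> = (\<Sum>L\<in>LL. int s + (\<Sum>L'\<in>LL - {L}. c L L'))"
    using LL(3) by (intro sum.cong refl) (simp add: sum.remove[OF fin] c_def)
  also have "\<dots> = (\<Sum>L\<in>LL. int s + int s + (\<Sum>L'\<in>LL - {L}. c L L' - 1))"
    using LL(1) by (intro sum.cong refl) (simp add: sum_subtractf)
  finally have "(\<Sum>P\<in>X. r P * r P) = 2 * int (s * Suc s) + (\<Sum>L\<in>LL. \<Sum>L'\<in>LL - {L}. c L L' - 1)"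
    using LL(1) by (simp add: sum.distrib ring_distribs)
  moreover have "(\<Sum>P\<in>X. (r P - 1) * (r P - 2)) = (\<Sum>P\<in>X. r P * r P) - 3 * (\<Sum>P\<in>X. r P) + 2 * int (card X)"
    by (simp add: algebra_simps sum.distrib sum_subtractf flip: sum_distrib_left sum_distrib_right)
  moreover have card_X: "2 * int (card X) = int (s * Suc s)" using X(3) by linarith
  \<comment> \<open>The main terms \<open>2 s (s + 1) - 3 s (s + 1) + s (s + 1)\<close> cancel. What
    remains equates a sum of nonnegative terms with a sum of nonpositive ones, so all of them are
    0.\<close>
  ultimately have key: "(\<Sum>P\<in>X. (r P - 1) * (r P - 2)) = (\<Sum>L\<in>LL. \<Sum>L'\<in>LL - {L}. c L L' - 1)"
    using sum_r by linarith
  \<comment> \<open>No integer lies strictly between 1 and 2.\<close>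
  have nonneg: "(r P - 1) * (r P - 2) \<ge> 0" for P
  proof (cases "r P \<le> 1")
    case True
    then show ?thesis by (intro mult_nonpos_nonpos) auto
  qed auto
  have inner: "(\<Sum>L'\<in>LL - {L}. 1 - c L L') \<ge> 0" if "L \<in> LL" for L
    using c_le[OF that] by (intro sum_nonneg) auto
  have neg: "(\<Sum>L\<in>LL. \<Sum>L'\<in>LL - {L}. 1 - c L L') = - (\<Sum>L\<in>LL. \<Sum>L'\<in>LL - {L}. c L L' - 1)"
    by (simp add: sum_subtractf algebra_simps flip: sum_negf)
  have "(\<Sum>P\<in>X. (r P - 1) * (r P - 2)) \<ge> 0" using nonneg by (intro sum_nonneg)
  moreover have "(\<Sum>L\<in>LL. \<Sum>L'\<in>LL - {L}. 1 - c L L') \<ge> 0" by (rule sum_nonneg[OF inner])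
  ultimately have z1: "(\<Sum>P\<in>X. (r P - 1) * (r P - 2)) = 0"
    and z2: "(\<Sum>L\<in>LL. \<Sum>L'\<in>LL - {L}. 1 - c L L') = 0"
    using key neg by linarith+
  have meet: "c L L' = 1" if "L \<in> LL" "L' \<in> LL" "L \<noteq> L'" for L L'
  proof -
    have "(\<Sum>L'\<in>LL - {L}. 1 - c L L') = 0"
      using sum_nonneg_eq_0_iff[of LL "\<lambda>L. \<Sum>L'\<in>LL - {L}. 1 - c L L'", OF fin inner] z2 that(1)
      by blast
    then show ?thesis using that fin c_le by (subst (asm) sum_nonneg_eq_0_iff) auto
  qed
  have r12: "r P = 1 \<or> r P = 2" if "P \<in> X" for P
    using z1 nonneg that X(1) by (subst (asm) sum_nonneg_eq_0_iff) auto
  \<comment> \<open>The values 1 and 2 have average 2, which excludes 1.\<close>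
  have "(\<Sum>P\<in>X. 2 - r P) = 0"
    using sum_r card_X by (simp add: sum_subtractf)
  then have two: "r P = 2" if "P \<in> X" for P
    using r12 that X(1) by (subst (asm) sum_nonneg_eq_0_iff) force+
  show ?thesis
    by unfold_locales (use s X LL fin meet two in \<open>auto simp: c_def r_def\<close>)
qed

section \<open>Fat points on a star configuration and their residuals\<close>

context star_configuration
begin

text \<open>The multiplicity depends on the point, since residuation with respect to a line lowers
  it only on that line. As for \<open>forms\<close>, index \<open>n\<close> means degree
  \<open>n - 1\<close>.\<close>

definition fat :: "('k vec3 set \<Rightarrow> nat) \<Rightarrow> nat \<Rightarrow> 'k mpoly set" where
  "fat \<mu> n = {F \<in> forms n. \<forall>P\<in>X. \<forall>p\<in>P. vanishes p (\<mu> P) F}"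

lemma fat_cong: "(\<And>P. P \<in> X \<Longrightarrow> \<mu> P = \<nu> P) \<Longrightarrow> fat \<mu> n = fat \<nu> n"
  by (simp add: fat_def)

lemma subspace_vanishing_forms:
  "mp.subspace {F \<in> forms n. \<forall>P\<in>Y. \<forall>p\<in>P. vanishes p (\<mu> P) F}"
proof -
  have "{F \<in> forms n. \<forall>P\<in>Y. \<forall>p\<in>P. vanishes p (\<mu> P) F} =
      forms n \<inter> (\<Inter>P\<in>Y. \<Inter>p\<in>P. {F. vanishes p (\<mu> P) F})" by blast
  moreover have "mp.subspace \<dots>"
    by (intro mp.subspace_inter subspace_forms mp.subspace_Inter)
      (auto intro!: mp.subspace_Inter subspace_vanishes)
  ultimately show ?thesis by simp
qed

lemma subspace_fat: "mp.subspace (fat \<mu> n)"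
  unfolding fat_def by (rule subspace_vanishing_forms)

lemma dim_forms_le_dim_fat:
  "n * Suc n \<le> 2 * mp.dim (fat \<mu> n) + (\<Sum>P\<in>X. \<mu> P * Suc (\<mu> P))"
proof -
  have "n * Suc n \<le> 2 * mp.dim {F \<in> forms n. \<forall>P\<in>Y. \<forall>p\<in>P. vanishes p (\<mu> P) F} + (\<Sum>P\<in>Y. \<mu> P * Suc (\<mu> P))"
    if "finite Y" "Y \<subseteq> X" for Y
    using that
  proof (induction Y rule: finite_induct)
    case empty
    show ?case using dim_forms[of n, where 'k = 'k] by simp
  next
    case (insert P Y)
    let ?U = "{F \<in> forms n. \<forall>P\<in>Y. \<forall>p\<in>P. vanishes p (\<mu> P) F}"
    have P: "is_proj_point P" using insert points by auto
    then obtain p where p: "p \<in> P" using proj_point_nonempty by blast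
    have "2 * mp.dim ?U \<le> 2 * mp.dim {F \<in> ?U. vanishes p (\<mu> P) F} + \<mu> P * Suc (\<mu> P)"
      by (rule dim_le_dim_vanishes[OF is_proj_pointD(1)[OF P p] subspace_vanishing_forms]) auto
    also have "{F \<in> ?U. vanishes p (\<mu> P) F} = {F \<in> forms n. \<forall>P\<in>insert P Y. \<forall>p\<in>P. vanishes p (\<mu> P) F}"
    proof -
      \<comment> \<open>One representative suffices: the order amounts to membership in a power of
        the point ideal, which depends on \<open>P\<close> alone.\<close>
      have "vanishes p (\<mu> P) F \<longleftrightarrow> (\<forall>q\<in>P. vanishes q (\<mu> P) F)" if "F \<in> forms n" for F
        using vanishes_ideal_power[OF P p that] ideal_power_vanishes[of F P "\<mu> P"] p by blast
      then show ?thesis by (intro Collect_cong) (simp, blast)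
    qed
    finally show ?case using insert by simp
  qed
  from this[OF finite_X order_refl] show ?thesis unfolding fat_def .
qed

text \<open>The multiplicities of the residual scheme. Truncation at 0 is right because vanishing to
  order 0 is no condition.\<close>

definition drop_line :: "'k vec3 set set \<Rightarrow> ('k vec3 set \<Rightarrow> nat) \<Rightarrow> 'k vec3 set \<Rightarrow> nat" where
  "drop_line L \<mu> P = (if P \<in> L then \<mu> P - 1 else \<mu> P)"

text \<open>Multiplication by the form of the line raises the order by exactly one at points of the
  line and leaves it unchanged elsewhere.\<close>

lemma fat_line_multiples:
  assumes a: "a \<noteq> (0, 0, 0)"
  shows "{F \<in> fat \<mu> (Suc n). \<exists>G\<in>forms n. F = linear_form a * G}
    = (*) (linear_form a) ` fat (drop_line (proj_line_of a) \<mu>) n"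
proof -
  have van: "vanishes p (\<mu> P) (linear_form a * G) \<longleftrightarrow> vanishes p (drop_line (proj_line_of a) \<mu> P) G"
    if P: "P \<in> X" "p \<in> P" and G: "G \<in> forms n" for P p G
  proof (cases "P \<in> proj_line_of a")
    case True
    have 0: "lin_eval a p = 0" using proj_line_of_iff[OF points P(2)] P(1) True by simp
    have p: "p \<noteq> (0, 0, 0)" using is_proj_pointD(1)[OF points P(2)] P(1) .
    show ?thesis
      using vanishes_linear_mult_Suc[OF 0] vanishes_linear_cancel_Suc[OF a p 0 G]
      by (cases "\<mu> P") (auto simp: drop_line_def True)
  next
    case False
    then have 0: "lin_eval a p \<noteq> 0" using proj_line_of_iff[OF points P(2)] P(1) by simp
    show ?thesis
      using vanishes_linear_mult[of p "\<mu> P" G a] vanishes_linear_cancel[OF 0] by (auto simp: drop_line_def False)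
  qed
  have "linear_form a * G \<in> fat \<mu> (Suc n) \<longleftrightarrow> G \<in> fat (drop_line (proj_line_of a) \<mu>) n"
    if "G \<in> forms n" for G
    using van[OF _ _ that] linear_form_mult_forms[OF that, of a] that unfolding fat_def by simp
  moreover have "fat (drop_line (proj_line_of a) \<mu>) n \<subseteq> forms n" by (simp add: fat_def)
  ultimately show ?thesis by blast
qed

text \<open>The residual sequence: restriction to \<open>L\<close> has the residual system, one
  degree lower, as its kernel, and the first bound estimates the image by binary forms with
  prescribed zeros.\<close>

lemma dim_fat_line:
  assumes "is_proj_line L"
  shows "mp.dim (fat \<mu> (Suc n)) \<le> mp.dim (fat (drop_line L \<mu>) n) + (Suc n - (\<Sum>P\<in>X \<inter> L. \<mu> P))"
    and "mp.dim (fat (drop_line L \<mu>) n) \<le> mp.dim (fat \<mu> (Suc n))"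
proof -
  obtain a where a: "a \<noteq> (0, 0, 0)" "L = proj_line_of a"
    using assms unfolding is_proj_line_def by blast
  let ?K = "{F \<in> fat \<mu> (Suc n). \<exists>G\<in>forms n. F = linear_form a * G}"
  obtain W :: "'k mpoly set" where W: "finite W" "forms n \<subseteq> mp.span W"
    using forms_subset_finite_span .
  obtain W' :: "'k mpoly set" where W': "finite W'" "forms (Suc n) \<subseteq> mp.span W'"
    using forms_subset_finite_span .
  have "inj ((*) (linear_form a))" using linear_form_nonzero[OF a(1)] by (simp add: inj_def)
  then have K: "mp.dim ?K = mp.dim (fat (drop_line L \<mu>) n)"
    unfolding fat_line_multiples[OF a(1)] a(2)
    by (rule mp.dim_image_inj[OF linear_mult_left]) (use W in \<open>auto simp: fat_def\<close>)
  have "mp.dim (fat \<mu> (Suc n)) \<le> mp.dim ?K + (Suc n - (\<Sum>P\<in>X \<inter> L. \<mu> P))"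
    by (rule dim_le_dim_line_multiples[OF a(1) _ _ subspace_fat])
      (use finite_X a(2) in \<open>auto simp: fat_def\<close>)
  then show "mp.dim (fat \<mu> (Suc n)) \<le> mp.dim (fat (drop_line L \<mu>) n) + (Suc n - (\<Sum>P\<in>X \<inter> L. \<mu> P))"
    by (simp only: K)
  have "fat \<mu> (Suc n) \<subseteq> mp.span W'" using W'(2) by (auto simp: fat_def)
  then obtain B where B: "B \<subseteq> fat \<mu> (Suc n)" "mp.independent B" "finite B"
      "fat \<mu> (Suc n) \<subseteq> mp.span B" "card B = mp.dim (fat \<mu> (Suc n))"
    using mp.basis_of_subset_finite_span[OF _ W'(1)] by metis
  have "mp.dim ?K \<le> card B" using B(3,4) by (intro mp.dim_le_card) auto
  then show "mp.dim (fat (drop_line L \<mu>) n) \<le> mp.dim (fat \<mu> (Suc n))" by (simp only: K B(5))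
qed

text \<open>The multiplicities that remain of \<open>kX\<close> after residuating with respect to the lines in \<open>A\<close>.\<close>

definition mult_off :: "'k vec3 set set set \<Rightarrow> nat \<Rightarrow> 'k vec3 set \<Rightarrow> nat" where
  "mult_off A k P = k - card {L\<in>A. P \<in> L}"

lemma mult_off_empty: "mult_off {} k = (\<lambda>_. k)"
  by (simp add: mult_off_def fun_eq_iff)

lemma mult_off_insert:
  assumes "finite A" "L \<notin> A"
  shows "mult_off (insert L A) k = drop_line L (mult_off A k)"
proof
  fix P
  have "{L'\<in>insert L A. P \<in> L'} = (if P \<in> L then insert L {L'\<in>A. P \<in> L'} else {L'\<in>A. P \<in> L'})" by auto
  then show "mult_off (insert L A) k P = drop_line L (mult_off A k) P"
    using assms by (simp add: mult_off_def drop_line_def)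
qed

text \<open>Each line of \<open>A\<close> takes 1 away at its single common point with
  \<open>L\<close>. Subtraction is never truncated there: of the two lines through a point of
  \<open>L\<close> one is \<open>L\<close> itself, so at most one lies in \<open>A\<close>, and
  \<open>k \<ge> 1\<close>.\<close>

lemma sum_mult_off:
  assumes "L \<in> LL" "A \<subseteq> LL" "L \<notin> A" "k \<ge> 1"
  shows "(\<Sum>P\<in>X \<inter> L. mult_off A k P) + card A = k * s"
proof -
  have fin: "finite A" using assms(2) finite_LL finite_subset by blast
  have le: "card {L'\<in>A. P \<in> L'} \<le> k" if "P \<in> X \<inter> L" for P
  proof -
    have "card (insert L {L'\<in>A. P \<in> L'}) \<le> card {L\<in>LL. P \<in> L}"
      using assms that finite_LL by (intro card_mono) auto
    then show ?thesis using two_lines that assms fin by simp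
  qed
  have "card A = (\<Sum>L'\<in>A. card (X \<inter> L \<inter> L'))"
    using card_meet[OF assms(1)] assms(2,3) by (subst sum.cong[OF refl, where h = "\<lambda>_. 1"]) auto
  also have "\<dots> = (\<Sum>P\<in>X \<inter> L. card {L'\<in>A. P \<in> L'})"
    using sum_weighted_incidences[of "X \<inter> L" A "\<lambda>_. 1 :: nat"] finite_X fin by simp
  finally have "(\<Sum>P\<in>X \<inter> L. mult_off A k P) + card A = (\<Sum>P\<in>X \<inter> L. mult_off A k P + card {L'\<in>A. P \<in> L'})"
    by (simp add: sum.distrib)
  also have "\<dots> = (\<Sum>P\<in>X \<inter> L. k)" using le by (intro sum.cong) (auto simp: mult_off_def)
  also have "\<dots> = k * s" using card_line[OF assms(1)] by simp
  finally show ?thesis .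
qed

definition independent_conditions :: "('k vec3 set \<Rightarrow> nat) \<Rightarrow> nat \<Rightarrow> bool" where
  "independent_conditions \<mu> n \<longleftrightarrow> 2 * mp.dim (fat \<mu> n) + (\<Sum>P\<in>X. \<mu> P * Suc (\<mu> P)) = n * Suc n"

lemma independent_conditions_cong:
  "(\<And>P. P \<in> X \<Longrightarrow> \<mu> P = \<nu> P) \<Longrightarrow> independent_conditions \<mu> n = independent_conditions \<nu> n"
  using fat_cong[of \<mu> \<nu>] by (simp add: independent_conditions_def)

text \<open>Let \<open>x\<close> be the sum of the multiplicities on \<open>L\<close>. As
  \<open>\<mu> (\<mu> + 1) - (\<mu> - 1) \<mu> = 2 \<mu>\<close>, dropping \<open>L\<close> removes
  \<open>x\<close> conditions, while restriction adds at most \<open>Suc n - x\<close> dimensions.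
  The bound on \<open>x\<close> makes this a true difference, so the upper bound meets the lower
  one.\<close>

lemma independent_conditions_line:
  assumes "is_proj_line L" "independent_conditions (drop_line L \<mu>) n" "(\<Sum>P\<in>X \<inter> L. \<mu> P) \<le> Suc n"
  shows "independent_conditions \<mu> (Suc n)"
proof -
  have arith: "2 * a + d \<le> f + 2 * c"
    if "a \<le> b + (c - x)" "2 * b + e = f" "d = e + 2 * x" "x \<le> c" for a b c d e f x :: nat
    using that by linarith
  have "(\<Sum>P\<in>X. \<mu> P * Suc (\<mu> P)) = (\<Sum>P\<in>X. drop_line L \<mu> P * Suc (drop_line L \<mu> P) + (if P \<in> L then 2 * \<mu> P else 0))"
  proof (intro sum.cong refl)
    fix P
    show "\<mu> P * Suc (\<mu> P) = drop_line L \<mu> P * Suc (drop_line L \<mu> P) + (if P \<in> L then 2 * \<mu> P else 0)"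
      by (cases "\<mu> P") (auto simp: drop_line_def)
  qed
  also have "\<dots> = (\<Sum>P\<in>X. drop_line L \<mu> P * Suc (drop_line L \<mu> P)) + 2 * (\<Sum>P\<in>X \<inter> L. \<mu> P)"
    using finite_X by (simp add: sum.distrib sum.If_cases sum_distrib_left)
  finally have "2 * mp.dim (fat \<mu> (Suc n)) + (\<Sum>P\<in>X. \<mu> P * Suc (\<mu> P)) \<le> n * Suc n + 2 * Suc n"
    by (rule arith[OF dim_fat_line(1)[OF assms(1)] assms(2)[unfolded independent_conditions_def] _ assms(3)])
  also have "\<dots> = Suc n * Suc (Suc n)" by simp
  finally show ?thesis
    using dim_forms_le_dim_fat[of "Suc n" \<mu>] unfolding independent_conditions_def by (rule antisym)
qed

text \<open>Putting back a line raises the degree by 1 and shrinks \<open>A\<close> by 1, so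
  \<open>n + card A\<close> is invariant; by \<open>sum_mult_off\<close> its comparison with
  \<open>k * s\<close> is just what the next line requires.\<close>

lemma independent_conditions_lines:
  assumes "A \<subseteq> LL" "k \<ge> 1" "k * s \<le> n + card A" "independent_conditions (mult_off A k) n"
  shows "independent_conditions (\<lambda>_. k) (n + card A)"
proof -
  have "finite A" using assms(1) finite_LL finite_subset by blast
  then show ?thesis
    using assms
  proof (induction A arbitrary: n rule: finite_induct)
    case empty
    then show ?case by (simp add: mult_off_empty)
  next
    case (insert L A)
    have "independent_conditions (mult_off A k) (Suc n)"
      using insert sum_mult_off[of L A k]
      by (intro independent_conditions_line[of L]) (auto simp: lines mult_off_insert)
    then show ?case using insert.IH[of "Suc n"] insert by simp
  qed
qed

lemma mult_off_all: "P \<in> X \<Longrightarrow> mult_off LL k P = k - 2"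
  by (simp add: mult_off_def two_lines)

text \<open>Splitting off all \<open>s + 1\<close> lines turns \<open>k\<close> into
  \<open>k - 2\<close>. The bound then falls by \<open>2 * s\<close>, the degree only by
  \<open>s + 1\<close>, so the hypothesis is inherited.\<close>

lemma independent_conditions_uniform:
  "Suc k * s \<le> n + 2 \<Longrightarrow> independent_conditions (\<lambda>_. k) n"
proof (induction k arbitrary: n rule: less_induct)
  case (less k)
  consider "k = 0" | "k = 1" | "k \<ge> 2" by linarith
  then show ?case
  proof cases
    case 1
    then show ?thesis using dim_forms[of n, where 'k = 'k] by (simp add: independent_conditions_def fat_def)
  next
    case 2
    \<comment> \<open>Only \<open>s\<close> lines are split off: for \<open>s = n = 2\<close> there
      is no room for \<open>s + 1\<close>. Every point still lies on one of them, as it lies on two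
      of the \<open>s + 1\<close>.\<close>
    obtain A where A: "A \<subseteq> LL" "card A = s" "finite A"
      using obtain_subset_with_card_n[of s LL] card_LL by auto
    have n: "n = (n - s) + card A" using less.prems 2 s_ge_2 A(2) by simp
    have "mult_off A 1 P = 0" if "P \<in> X" for P
    proof -
      have "card {L\<in>LL. P \<in> L} \<le> card ({L\<in>A. P \<in> L} \<union> (LL - A))"
        using finite_LL A by (intro card_mono) auto
      also have "\<dots> \<le> card {L\<in>A. P \<in> L} + card (LL - A)" by (rule card_Un_le)
      also have "card (LL - A) = 1" using A card_LL by (simp add: card_Diff_subset)
      finally show ?thesis using two_lines[OF that] by (simp add: mult_off_def)
    qed
    then have "independent_conditions (mult_off A 1) (n - s) = independent_conditions (\<lambda>_. 0) (n - s)"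
      by (intro independent_conditions_cong) auto
    moreover have "independent_conditions (\<lambda>_. 0) (n - s)"
      using less.IH[of 0 "n - s"] less.prems 2 by simp
    ultimately show ?thesis
      using independent_conditions_lines[of A 1 "n - s"] A n less.prems 2 s_ge_2 by simp
  next
    case 3
    obtain j where j: "k = Suc (Suc j)" using 3 by (metis add_2_eq_Suc le_Suc_ex)
    have js: "3 * s + j * s \<le> n + 2" using less.prems by (simp add: j)
    have n: "n = (n - Suc s) + card LL" using js s_ge_2 card_LL by simp
    have "independent_conditions (mult_off LL k) (n - Suc s) = independent_conditions (\<lambda>_. j) (n - Suc s)"
      using mult_off_all by (intro independent_conditions_cong) (auto simp: j)
    moreover have "independent_conditions (\<lambda>_. j) (n - Suc s)"
      using less.IH[of j "n - Suc s"] js s_ge_2 by (simp add: j)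
    ultimately show ?thesis
      using independent_conditions_lines[of LL k "n - Suc s"] n js s_ge_2 by (simp add: j)
  qed
qed

text \<open>Bezout in dimension form: the multiplicities on the next line exceed the degree, so the
  restriction term of \<open>dim_fat_line\<close> truncates to 0 and both bounds coincide.\<close>

lemma dim_fat_forced_lines:
  assumes "A \<subseteq> LL" "k \<ge> 1" "n + card A \<le> k * s"
  shows "mp.dim (fat (\<lambda>_. k) (n + card A)) = mp.dim (fat (mult_off A k) n)"
proof -
  have "finite A" using assms(1) finite_LL finite_subset by blast
  then show ?thesis
    using assms
  proof (induction A arbitrary: n rule: finite_induct)
    case empty
    then show ?case by (simp add: mult_off_empty)
  next
    case (insert L A)
    have "mp.dim (fat (mult_off A k) (Suc n)) = mp.dim (fat (mult_off (insert L A) k) n)"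
      using dim_fat_line[of L "mult_off A k" n] sum_mult_off[of L A k] insert
      by (simp add: lines mult_off_insert)
    then show ?case using insert.IH[of "Suc n"] insert by simp
  qed
qed

lemma dim_fat_diff:
  assumes "m \<ge> 2"
  shows "mp.dim (fat (\<lambda>_. m) (m * s)) + Suc s = mp.dim (fat (\<lambda>_. m) (m * s - 1)) + m * s"
proof -
  obtain j where j: "m = Suc (Suc j)" using assms by (metis add_2_eq_Suc le_Suc_ex)
  define N where "N = s - 2 + j * s"
  have N: "m * s = Suc N + card LL" "m * s - 1 = N + card LL"
    using s_ge_2 card_LL by (simp_all add: N_def j)
  have red: "mp.dim (fat (\<lambda>_. m) (n + card LL)) = mp.dim (fat (\<lambda>_. j) n)" if "n \<le> Suc N" for n
    using dim_fat_forced_lines[of LL m n] that N(1) fat_cong[of "mult_off LL m" "\<lambda>_. j" n] mult_off_all by (simp add: j)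
  have "independent_conditions (\<lambda>_. j) n" if "N \<le> n" for n
    using that s_ge_2 by (intro independent_conditions_uniform) (simp add: N_def)
  \<comment> \<open>The conditions imposed by the points are the same in both degrees and cancel;
    only the growth of the space of forms remains.\<close>
  from this[of N] this[of "Suc N"]
  have "mp.dim (fat (\<lambda>_. j) (Suc N)) = mp.dim (fat (\<lambda>_. j) N) + Suc N"
    unfolding independent_conditions_def by simp
  then show ?thesis unfolding N(2) using N(1) red[of "Suc N"] red[of N] card_LL by simp
qed

end

text \<open>The blocks are disjoint, since \<open>Xs i\<close> lies on \<open>L i\<close> and
  \<open>L i\<close> avoids all earlier blocks; hence the sizes \<open>1, ..., s\<close> add
  up.\<close>

lemma k_configuration_card:
  assumes "k_configuration X s (\<lambda>i. i)"
  shows "finite X" "\<And>P. P \<in> X \<Longrightarrow> is_proj_point P" "2 * card X = s * Suc s"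
proof -
  show fin: "finite X" and "\<And>P. P \<in> X \<Longrightarrow> is_proj_point P"
    using assms unfolding k_configuration_def by auto
  obtain Xs L where XL: "X = (\<Union>i\<in>{1..s}. Xs i)"
      "\<forall>i\<in>{1..s}. Xs i \<subseteq> X \<and> card (Xs i) = i \<and> is_proj_line (L i) \<and> Xs i \<subseteq> L i"
      "\<forall>i\<in>{1..s}. \<forall>j\<in>{1..s}. i \<noteq> j \<longrightarrow> L i \<noteq> L j"
      "\<forall>i\<in>{1..s}. \<forall>j\<in>{1..s}. j < i \<longrightarrow> L i \<inter> Xs j = {}"
    using assms unfolding k_configuration_def by (elim exE conjE) (rule that)
  have disj: "Xs i \<inter> Xs j = {}" if "i \<in> {1..s}" "j \<in> {1..s}" "i \<noteq> j" for i j
  proof -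
    have "Xs i \<inter> Xs j = {}" if "i \<in> {1..s}" "j \<in> {1..s}" "j < i" for i j
      using XL(2,4) that by blast
    then show ?thesis using that by (metis Int_commute linorder_neqE_nat)
  qed
  have "card X = (\<Sum>i\<in>{1..s}. card (Xs i))"
    unfolding XL(1) using XL(2) fin disj by (intro card_UN_disjoint) (auto intro: finite_subset)
  also have "\<dots> = \<Sum>{1..s}" using XL(2) by (intro sum.cong) auto
  also have "2 * \<dots> = s * Suc s" by (induction s) auto
  finally show "2 * card X = s * Suc s" .
qed

section \<open>Passage to the Hilbert function\<close>

lemma ringR_deg_eq_forms: "ringR_deg t = forms (Suc t)"
  by (auto simp: ringR_deg_def forms_def)

lemma (in star_configuration) fat_ideal_degree:
  "fat_ideal X m \<inter> ringR_deg t = fat (\<lambda>_. m) (Suc t)"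
proof -
  have "F \<in> ideal_power (point_ideal P) m \<longleftrightarrow> (\<forall>p\<in>P. vanishes p m F)" if P: "P \<in> X" "F \<in> forms (Suc t)" for P F
  proof -
    obtain p where "p \<in> P" using proj_point_nonempty[OF points[OF P(1)]] by blast
    then show ?thesis
      using vanishes_ideal_power[OF points[OF P(1)] _ P(2)] ideal_power_vanishes by blast
  qed
  then show ?thesis
    unfolding ringR_deg_eq_forms fat_ideal_def fat_def by (auto simp: forms_def)
qed

theorem theorem4p2:
  fixes X :: "'k::alg_closed_field vec3 set set" and s :: nat
  assumes "s \<ge> 2"
    and "k_configuration X s (\<lambda>i. i)"
    and "card {L. is_proj_line L \<and> card (X \<inter> L) = s} = s + 1"
  shows "\<forall>m::nat. m \<ge> 2 \<longrightarrow>
           delta_hilbert_fun (fat_ideal X m) (int m * int s - 1) = int s + 1"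
proof (intro allI impI)
  fix m :: nat assume m: "m \<ge> 2"
  interpret star_configuration X "{L. is_proj_line L \<and> card (X \<inter> L) = s}" s
    using assms k_configuration_card[OF assms(2)] by (intro star_configurationI) auto
  \<comment> \<open>With \<open>m * s = N + 2\<close> the two degrees involved are
    \<open>N + 1\<close> and \<open>N\<close>, free of truncated subtraction.\<close>
  define N where "N = m * s - 2"
  have "2 * 2 \<le> m * s" using m s_ge_2 by (rule mult_le_mono)
  then have N: "m * s = Suc (Suc N)" by (simp add: N_def)
  then have "int m * int s - 1 = int (Suc N)" by (simp flip: of_nat_mult)
  then have delta: "delta_hilbert_fun (fat_ideal X m) (int m * int s - 1)
      = hilbert_fun (fat_ideal X m) (int (Suc N)) - hilbert_fun (fat_ideal X m) (int N)"
    by (simp add: delta_hilbert_fun_def)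
  have dim: "2 * int (mp.dim (forms n :: 'k mpoly set)) = int (n * Suc n)" for n
    using dim_forms[of n, where 'k = 'k] by (metis of_nat_mult of_nat_numeral)
  have H: "2 * hilbert_fun (fat_ideal X m) (int t)
      = int (Suc t * Suc (Suc t)) - 2 * int (mp.dim (fat (\<lambda>_. m) (Suc t)))" for t
    using dim[of "Suc t"]
    by (simp add: hilbert_fun_def kdim_eq_dim fat_ideal_degree[unfolded ringR_deg_eq_forms] ringR_deg_eq_forms)
  have "mp.dim (fat (\<lambda>_. m) (Suc (Suc N))) + Suc s = mp.dim (fat (\<lambda>_. m) (Suc N)) + Suc (Suc N)"
    using dim_fat_diff[OF m] by (simp add: N)
  \<comment> \<open>The ring grows by \<open>N + 2 = m * s\<close> and the ideal by
    \<open>m * s - (s + 1)\<close>.\<close>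
  then have "2 * (hilbert_fun (fat_ideal X m) (int (Suc N)) - hilbert_fun (fat_ideal X m) (int N)) = 2 * (int s + 1)"
    unfolding right_diff_distrib H by (simp add: algebra_simps)
  then show "delta_hilbert_fun (fat_ideal X m) (int m * int s - 1) = int s + 1" unfolding delta by simp
qed

end
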